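(* Let $d\ge1$, $\Omega=[0,1]^d$, let $s\ge 2$ be an integer, $R>0$, and let $V\in L^\infty(\Omega)$ be fixed. For $u^\ast$ in the class $\mathcal U_{s,R}:=\{u\in H^s(\Omega)\cap H^1_0(\Omega):\|u\|_{H^s(\Omega)}\le R\}$ put $f=-\Delta u^\ast+Vu^\ast$, and suppose one observes $n$ i.i.d. pairs $(X_i,f_i)$, $i=1,\dots,n$, where $X_i$ is uniform on $\Omega$ and $f_i=f(X_i)+\xi_i$ with $\xi_i\sim N(0,1)$ independent of $X_i$. Then there is a constant $c>0$ (independent of $n$) such that for all $n\ge1$: $$\inf_{\psi}\sup_{u^\ast\in\mathcal U_{s,R}}\mathbb E\,\big\|\psi(\{X_i,f_i\}_{i=1}^n)-u^\ast\big\|_{H^1(\Omega)}^2\ \ge\ c\,n^{-\frac{2s-2}{d+2s-4}},$$ $$\inf_{\psi}\sup_{u^\ast\in\mathcal U_{s,R}}\mathbb E\,\big\|\psi(\{X_i,f_i\}_{i=1}^n)-u^\ast\big\|_{H^2(\Omega)}^2\ \ge\ c\,n^{-\frac{2s-4}{d+2s-4}},$$ where the infima range over all measurable estimators $\psi:(\mathbb R^d)^{n}\times\mathbb R^{n}\to H^s(\Omega)$.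
   Context: The expectation is over the i.i.d. sample. $H^k(\Omega)$ denotes the usual Sobolev space with norm $\|v\|_{H^k}^2=\sum_{|\alpha|\le k}\|D^\alpha v\|_{L^2}^2$. *)

theory Defs
  imports "HOL-Analysis.Analysis" "HOL-Probability.Probability"
begin

definition Omega :: "(real^'n) set" where
  "Omega = {x. \<forall>i. 0 \<le> x$i \<and> x$i \<le> 1}"

definition partial :: "'n \<Rightarrow> (real^'n \<Rightarrow> real) \<Rightarrow> real^'n \<Rightarrow> real" where
  "partial i f x = deriv (\<lambda>t. f (x + t *\<^sub>R axis i 1)) 0"

fun dpart :: "'n list \<Rightarrow> (real^'n \<Rightarrow> real) \<Rightarrow> real^'n \<Rightarrow> real" where
  "dpart [] f = f"
| "dpart (i # is) f = partial i (dpart is f)"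

definition cderiv :: "('n \<Rightarrow> nat) \<Rightarrow> (real^'n \<Rightarrow> real) \<Rightarrow> real^'n \<Rightarrow> real" where
  "cderiv \<alpha> f = dpart (SOME l. \<forall>i. count_list l i = \<alpha> i) f"

definition smooth :: "(real^'n \<Rightarrow> real) \<Rightarrow> bool" where
  "smooth f \<longleftrightarrow> (\<forall>l. continuous_on UNIV (dpart l f) \<and>
      (\<forall>i x. (\<lambda>t. dpart l f (x + t *\<^sub>R axis i 1)) differentiable (at 0)))"

definition test_fun :: "(real^'n \<Rightarrow> real) \<Rightarrow> bool" where
  "test_fun \<phi> \<longleftrightarrow> smooth \<phi> \<and> compact (closure {x. \<phi> x \<noteq> 0})
      \<and> closure {x. \<phi> x \<noteq> 0} \<subseteq> interior Omega"

definition L2 :: "(real^'n \<Rightarrow> real) \<Rightarrow> bool" where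
  "L2 g \<longleftrightarrow> g \<in> borel_measurable borel \<and> set_integrable lborel Omega (\<lambda>x. (g x)\<^sup>2)"

definition is_weak_deriv :: "('n \<Rightarrow> nat) \<Rightarrow> (real^'n \<Rightarrow> real) \<Rightarrow> (real^'n \<Rightarrow> real) \<Rightarrow> bool" where
  "is_weak_deriv \<alpha> u g \<longleftrightarrow> L2 g \<and>
     (\<forall>\<phi>. test_fun \<phi> \<longrightarrow>
        (LINT x:Omega|lborel. u x * cderiv \<alpha> \<phi> x)
          = (-1) ^ (sum \<alpha> UNIV) * (LINT x:Omega|lborel. g x * \<phi> x))"

definition wderiv :: "('n \<Rightarrow> nat) \<Rightarrow> (real^'n \<Rightarrow> real) \<Rightarrow> real^'n \<Rightarrow> real" where
  "wderiv \<alpha> u = (SOME g. is_weak_deriv \<alpha> u g)"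

definition Hk :: "nat \<Rightarrow> (real^'n \<Rightarrow> real) set" where
  "Hk k = {u. L2 u \<and> (\<forall>\<alpha>. sum \<alpha> UNIV \<le> k \<longrightarrow> (\<exists>g. is_weak_deriv \<alpha> u g))}"

definition sob_norm :: "nat \<Rightarrow> (real^'n \<Rightarrow> real) \<Rightarrow> real" where
  "sob_norm k u = sqrt (\<Sum>\<alpha>\<in>{\<alpha>::'n\<Rightarrow>nat. sum \<alpha> UNIV \<le> k}.
                         LINT x:Omega|lborel. (wderiv \<alpha> u x)\<^sup>2)"

definition H10 :: "(real^'n \<Rightarrow> real) set" where
  "H10 = {u. u \<in> Hk 1 \<and> (\<forall>\<epsilon>>0. \<exists>\<phi>. test_fun \<phi> \<and> sob_norm 1 (\<lambda>x. u x - \<phi> x) < \<epsilon>)}"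

definition Ucls :: "nat \<Rightarrow> real \<Rightarrow> (real^'n \<Rightarrow> real) set" where
  "Ucls s R = {u. u \<in> Hk s \<and> u \<in> H10 \<and> sob_norm s u \<le> R}"

definition wlap :: "(real^'n \<Rightarrow> real) \<Rightarrow> real^'n \<Rightarrow> real" where
  "wlap u x = (\<Sum>i\<in>UNIV. wderiv (\<lambda>j. if j = i then 2 else 0) u x)"

definition source :: "(real^'n \<Rightarrow> real) \<Rightarrow> (real^'n \<Rightarrow> real) \<Rightarrow> real^'n \<Rightarrow> real" where
  "source V u x = - wlap u x + V x * u x"

text \<open>Law of one observation (X, f(X) + xi), X uniform on Omega (which has volume 1),
  xi ~ N(0,1) independent of X.\<close>
definition obs_law :: "(real^'n \<Rightarrow> real) \<Rightarrow> (real^'n \<Rightarrow> real) \<Rightarrow> ((real^'n) \<times> real) measure" where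
  "obs_law V u = density (lborel \<Otimes>\<^sub>M lborel)
      (\<lambda>(x, y). ennreal (indicator Omega x * normal_density (source V u x) 1 y))"

definition sample_law :: "nat \<Rightarrow> (real^'n \<Rightarrow> real) \<Rightarrow> (real^'n \<Rightarrow> real)
     \<Rightarrow> (nat \<Rightarrow> (real^'n) \<times> real) measure" where
  "sample_law n V u = PiM {..<n} (\<lambda>_. obs_law V u)"

text \<open>Measurable estimators with values in H^s: Borel measurability w.r.t. the
  H^s-norm topology; since H^s is separable its Borel sigma-algebra is generated by
  the balls, i.e. by the distance maps to points w of H^s.\<close>
definition estimator :: "nat \<Rightarrow> nat \<Rightarrow> ((nat \<Rightarrow> (real^'n) \<times> real) \<Rightarrow> (real^'n \<Rightarrow> real)) \<Rightarrow> bool" where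
  "estimator s n \<psi> \<longleftrightarrow>
     (\<forall>\<omega>\<in>space (PiM {..<n} (\<lambda>_. borel :: ((real^'n) \<times> real) measure)). \<psi> \<omega> \<in> Hk s) \<and>
     (\<forall>w\<in>Hk s. (\<lambda>\<omega>. sob_norm s (\<lambda>x. \<psi> \<omega> x - w x))
                  \<in> borel_measurable (PiM {..<n} (\<lambda>_. borel :: ((real^'n) \<times> real) measure)))"

definition minimax_risk :: "(real^'n \<Rightarrow> real) \<Rightarrow> nat \<Rightarrow> real \<Rightarrow> nat \<Rightarrow> nat \<Rightarrow> ennreal" where
  "minimax_risk V s R n k =
     (INF \<psi>\<in>{\<psi>. estimator s n \<psi>}. SUP u\<in>Ucls s R.
        \<integral>\<^sup>+ \<omega>. ennreal ((sob_norm k (\<lambda>x. \<psi> \<omega> x - u x))\<^sup>2) \<partial>sample_law n V u)"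

end

theory Submission
  imports Defs "HOL-Computational_Algebra.Polynomial"
begin

text \<open>Assouad's method. On a grid of \<open>M\<^sup>d\<close> cells put bumps \<open>v\<^sub>j\<close> of height \<open>\<rho> M\<^bsup>-s\<^esup>\<close> with random signs. Their sum stays in
  the class, and flipping one sign changes the source by \<open>O(M\<^bsup>2-s\<^esup>)\<close> on one cell of volume \<open>M\<^bsup>-d\<^esup>\<close>, so
  for \<open>M \<approx> n\<^bsup>1/(d+2s-4)\<^esup>\<close> the Hellinger affinity of the two sample laws stays bounded below and the sign
  cannot be recovered. The derivatives \<open>\<partial>\<^sub>i\<^sup>k v\<^sub>j\<close> are orthogonal, so by Bessel's inequality the squared \<open>H\<^sup>k\<close> loss
  dominates the sum over \<open>j\<close> of the squared errors of \<open>\<langle>\<partial>\<^sub>i\<^sup>k \<psi>, \<partial>\<^sub>i\<^sup>k v\<^sub>j\<rangle>\<close>. These functionals are measurable in the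
  sample, unlike (a priori) the loss itself.\<close>

subsection \<open>Smooth functions\<close>

text \<open>The scaling fixes every exponent. As the cells are disjoint, each derivative of the sum
  is bounded like that of a single bump, so the height \<open>\<rho> / M^s\<close> offsets up to
  \<open>s\<close> derivatives. A sign flip shifts a unit-variance Gaussian mean by
  \<open>O(M^(2-s))\<close> on volume \<open>M^(-d)\<close>: one observation loses affinity of order
  \<open>M^(4-2s-d)\<close>, and \<open>n\<close> of them are affordable once
  \<open>n <= M^(d+2s-4)\<close>. The order \<open>k\<close> derivative of one bump has squared norm
  \<open>N\<close> of order \<open>M^(2k-2s-d)\<close>; each cell costs a fixed share of
  \<open>N\<close>, and all \<open>M^d\<close> cells together cost order \<open>M^(2k-2s)\<close>,
  which gives the two rates. Two definitions shape the rest. Weak derivatives are picked by choice,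
  so identities between them hold only almost everywhere, by a uniqueness theorem. An estimator is
  constrained only through its distances to fixed functions, so its linear functionals have to be
  recovered from distances by polarisation and a limit.\<close>

definition flat_exp :: "real poly \<Rightarrow> real \<Rightarrow> real" where
  "flat_exp p t = (if 0 < t then poly p (1 / t) * exp (- (1 / t)) else 0)"

lemma poly_times_exp_minus_tendsto_0:
  fixes p :: "real poly"
  shows "((\<lambda>x. poly p x * exp (- x)) \<longlongrightarrow> 0) at_top"
proof -
  have "((\<lambda>x. \<Sum>i\<le>degree p. coeff p i * (x ^ i / exp x)) \<longlongrightarrow> (\<Sum>i\<le>degree p. coeff p i * 0)) at_top"
    by (intro tendsto_intros tendsto_power_div_exp_0)
  then show ?thesis
    by (simp add: poly_altdef sum_distrib_right exp_minus divide_inverse mult.assoc)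
qed

lemma flat_exp_tendsto_0: "(flat_exp p \<longlongrightarrow> 0) (at 0)"
proof -
  have "((\<lambda>t. poly p (inverse t) * exp (- (inverse t))) \<longlongrightarrow> 0) (at_right 0)"
    by (rule filterlim_compose[OF poly_times_exp_minus_tendsto_0 filterlim_inverse_at_top_right])
  moreover have "\<forall>\<^sub>F t in at_right 0. poly p (inverse t) * exp (- (inverse t)) = flat_exp p t"
    by (auto simp: eventually_at_right_less flat_exp_def inverse_eq_divide
        intro: eventually_mono[OF eventually_at_right_less])
  ultimately have R: "(flat_exp p \<longlongrightarrow> 0) (at_right 0)"
    by (rule Lim_transform_eventually)
  have "\<forall>\<^sub>F t in at_left 0. 0 = flat_exp p t"
    by (auto simp: flat_exp_def eventually_at_filter intro!: always_eventually)
  then have L: "(flat_exp p \<longlongrightarrow> 0) (at_left 0)"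
    by (rule Lim_transform_eventually[OF tendsto_const])
  show ?thesis using L R by (simp add: filterlim_split_at)
qed

text \<open>The polynomial factor exists for this statement: differentiating
  \<open>p(1/t) exp(-1/t)\<close> replaces \<open>p\<close> by \<open>X^2 (p - p')\<close>, so the
  family is closed under derivatives, and every member is flat at 0.\<close>

lemma flat_exp_has_derivative:
  "(flat_exp p has_real_derivative flat_exp ([:0, 0, 1:] * (p - pderiv p)) t) (at t)"
proof (cases t "0::real" rule: linorder_cases)
  case less
  have "((\<lambda>t. 0) has_real_derivative 0) (at t)" by simp
  then have "(flat_exp p has_real_derivative 0) (at t)"
    by (rule has_field_derivative_transform_within_open[where S = "{..<0}"])
       (use less in \<open>auto simp: flat_exp_def\<close>)
  then show ?thesis using less by (simp add: flat_exp_def)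
next
  case greater
  have "((\<lambda>t. poly p (1 / t) * exp (- (1 / t))) has_real_derivative
          flat_exp ([:0, 0, 1:] * (p - pderiv p)) t) (at t)"
    using greater
    by (auto intro!: derivative_eq_intros DERIV_chain2[OF poly_DERIV]
        simp: flat_exp_def field_simps power2_eq_square)
  then show ?thesis
    by (rule has_field_derivative_transform_within_open[where S = "{0<..}"])
       (use greater in \<open>auto simp: flat_exp_def\<close>)
next
  case equal
  \<comment> \<open>Dividing by \<open>h\<close> multiplies the polynomial by \<open>X\<close>: the
    difference quotient at 0 is again a member of the family and tends to 0.\<close>
  have "((\<lambda>h. (flat_exp p h - flat_exp p 0) / (h - 0)) \<longlongrightarrow> 0) (at 0)"
  proof (rule Lim_transform_eventually[OF flat_exp_tendsto_0[of "[:0,1:] * p"]])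
    show "\<forall>\<^sub>F h in at 0. flat_exp ([:0,1:] * p) h = (flat_exp p h - flat_exp p 0) / (h - 0)"
      by (rule always_eventually) (auto simp: flat_exp_def)
  qed
  then show ?thesis using equal by (simp add: has_field_derivative_iff flat_exp_def)
qed

lemma partial_eqI:
  assumes "\<And>x. ((\<lambda>t. f (x + t *\<^sub>R axis i 1)) has_real_derivative g x) (at 0)"
  shows "partial i f = g"
  using assms by (auto simp: partial_def fun_eq_iff intro: DERIV_imp_deriv)

text \<open>A coinduction principle: all iterated partials of a member stay in the family, so a
  one-step check yields every order at once.\<close>

lemma smoothI_closed:
  assumes "f \<in> S"
    and "\<And>f. f \<in> S \<Longrightarrow> continuous_on UNIV f"
    and "\<And>f i. f \<in> S \<Longrightarrow> \<exists>g\<in>S. \<forall>x. ((\<lambda>t. f (x + t *\<^sub>R axis i 1)) has_real_derivative g x) (at 0)"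
  shows "smooth f"
proof -
  have *: "dpart l f \<in> S" for l
  proof (induction l)
    case (Cons i l)
    then show ?case using assms(3)[OF Cons] partial_eqI[of "dpart l f" i] by auto
  qed (use assms(1) in simp)
  show ?thesis
    unfolding smooth_def
  proof (intro allI conjI)
    fix l i x
    show "continuous_on UNIV (dpart l f)" using * assms(2) by blast
    show "(\<lambda>t. dpart l f (x + t *\<^sub>R axis i 1)) differentiable at 0"
      using assms(3)[OF *[of l], of i] by (auto simp: real_differentiable_def)
  qed
qed

text \<open>\<open>smooth\<close> quantifies over all iterated partials, for which a Leibniz rule is
  awkward. In this algebra one partial derivative is handled by induction and
  \<open>smoothI_closed\<close> does the rest; all bumps and their rescalings live here.\<close>

inductive_set flat_alg :: "(real^'n \<Rightarrow> real) set" where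
  const: "(\<lambda>x. c) \<in> flat_alg"
| flat: "(\<lambda>x. flat_exp p (m * x $ i + c)) \<in> flat_alg"
| add: "f \<in> flat_alg \<Longrightarrow> g \<in> flat_alg \<Longrightarrow> (\<lambda>x. f x + g x) \<in> flat_alg"
| mult: "f \<in> flat_alg \<Longrightarrow> g \<in> flat_alg \<Longrightarrow> (\<lambda>x. f x * g x) \<in> flat_alg"

lemma flat_alg_sum:
  "(\<And>j. j \<in> J \<Longrightarrow> f j \<in> flat_alg) \<Longrightarrow> (\<lambda>x. \<Sum>j\<in>J. f j x) \<in> flat_alg"
  by (induction J rule: infinite_finite_induct) (auto intro: flat_alg.intros)

lemma flat_alg_prod:
  "(\<And>j. j \<in> J \<Longrightarrow> f j \<in> flat_alg) \<Longrightarrow> (\<lambda>x. \<Prod>j\<in>J. f j x) \<in> flat_alg"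
  by (induction J rule: infinite_finite_induct) (auto intro: flat_alg.intros)

lemma flat_alg_continuous: "f \<in> flat_alg \<Longrightarrow> continuous_on UNIV f"
proof (induction rule: flat_alg.induct)
  case (flat p m i c)
  have "continuous_on UNIV (flat_exp p)"
    by (meson DERIV_isCont continuous_at_imp_continuous_on flat_exp_has_derivative)
  then show ?case
    by (rule continuous_on_compose2) (auto intro!: continuous_intros)
qed (auto intro: continuous_intros)

lemma flat_alg_partial:
  "f \<in> flat_alg \<Longrightarrow>
     \<exists>g\<in>flat_alg. \<forall>x. ((\<lambda>t. f (x + t *\<^sub>R axis i 1)) has_real_derivative g x) (at 0)"
proof (induction rule: flat_alg.induct)
  case (const c)
  show ?case by (rule bexI[OF _ flat_alg.const[of 0]]) auto
next
  case (flat p m k c)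
  let ?q = "[:0, 0, 1:] * (p - pderiv p)"
  have "((\<lambda>t. flat_exp p (m * (x + t *\<^sub>R axis i 1) $ k + c)) has_real_derivative
      m * (axis i 1 $ k) * flat_exp ?q (m * x $ k + c)) (at 0)" for x
  proof -
    have "((\<lambda>t. m * (x + t *\<^sub>R axis i 1) $ k + c) has_real_derivative m * (axis i 1 $ k)) (at 0)"
      by (auto intro!: derivative_eq_intros)
    from DERIV_cong[OF DERIV_chain2[OF flat_exp_has_derivative this]] show ?thesis
      by (simp add: mult_ac)
  qed
  moreover have "(\<lambda>x. m * (axis i 1 $ k) * flat_exp ?q (m * x $ k + c)) \<in> flat_alg"
    by (intro flat_alg.intros)
  ultimately show ?case by (intro bexI[where x = "\<lambda>x. m * (axis i 1 $ k) * flat_exp ?q (m * x $ k + c)"]) auto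
next
  case (add f g)
  then obtain f' g' where fg: "f' \<in> flat_alg" "g' \<in> flat_alg"
    "\<And>x. ((\<lambda>t. f (x + t *\<^sub>R axis i 1)) has_real_derivative f' x) (at 0)"
    "\<And>x. ((\<lambda>t. g (x + t *\<^sub>R axis i 1)) has_real_derivative g' x) (at 0)" by blast
  then show ?case
    by (intro bexI[where x = "\<lambda>x. f' x + g' x"]) (auto intro: flat_alg.intros DERIV_add)
next
  case (mult f g)
  then obtain f' g' where fg: "f' \<in> flat_alg" "g' \<in> flat_alg"
    "\<And>x. ((\<lambda>t. f (x + t *\<^sub>R axis i 1)) has_real_derivative f' x) (at 0)"
    "\<And>x. ((\<lambda>t. g (x + t *\<^sub>R axis i 1)) has_real_derivative g' x) (at 0)" by blast
  have "((\<lambda>t. f (x + t *\<^sub>R axis i 1) * g (x + t *\<^sub>R axis i 1)) has_real_derivative f' x * g x + g' x * f x) (at 0)" for x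
    using DERIV_mult[OF fg(3,4)] by simp
  moreover have "(\<lambda>x. f' x * g x + g' x * f x) \<in> flat_alg"
    using fg mult.hyps by (intro flat_alg.intros) auto
  ultimately show ?case by (intro bexI[where x = "\<lambda>x. f' x * g x + g' x * f x"]) auto
qed

lemma flat_alg_smooth: "f \<in> flat_alg \<Longrightarrow> smooth f"
  by (rule smoothI_closed[of f flat_alg]) (auto intro: flat_alg_continuous flat_alg_partial)

lemma dpart_append: "dpart (l @ l') f = dpart l (dpart l' f)"
  by (induction l) auto

lemma smooth_dpart: "smooth f \<Longrightarrow> smooth (dpart l f)"
  by (simp add: smooth_def flip: dpart_append)

lemma smooth_continuous: "smooth f \<Longrightarrow> continuous_on UNIV f"
  by (metis dpart.simps(1) smooth_def)

lemma smooth_measurable: "smooth f \<Longrightarrow> f \<in> borel_measurable borel"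
  by (simp add: borel_measurable_continuous_onI smooth_continuous)

text \<open>\<open>smooth\<close> speaks only of the derivative at parameter 0; re-basing the line
  at \<open>x + t e_i\<close> gives it at every \<open>t\<close>.\<close>

lemma smooth_has_partial:
  assumes "smooth f"
  shows "((\<lambda>t. f (x + t *\<^sub>R axis i 1)) has_real_derivative partial i f (x + t *\<^sub>R axis i 1)) (at t)"
proof -
  have "(\<lambda>s. f ((x + t *\<^sub>R axis i 1) + s *\<^sub>R axis i 1)) differentiable at 0"
    using assms unfolding smooth_def by (metis dpart.simps(1))
  then have "((\<lambda>s. f ((x + t *\<^sub>R axis i 1) + s *\<^sub>R axis i 1)) has_real_derivative
      partial i f (x + t *\<^sub>R axis i 1)) (at 0)"
    unfolding partial_def using DERIV_deriv_iff_real_differentiable by blast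
  then have "((\<lambda>s. f (x + (s + t) *\<^sub>R axis i 1)) has_real_derivative
      partial i f (x + t *\<^sub>R axis i 1)) (at 0)"
    by (simp add: algebra_simps)
  then show ?thesis
    using DERIV_at_within_shift[of "\<lambda>s. f (x + s *\<^sub>R axis i 1)" _ t 0 UNIV] by (simp add: add.commute)
qed

lemma smooth_has_partial0:
  assumes "smooth f"
  shows "((\<lambda>t. f (x + t *\<^sub>R axis i 1)) has_real_derivative partial i f x) (at 0)"
  using smooth_has_partial[OF assms, of x i 0] by simp

lemma dpart_linear_sum:
  assumes "\<And>j. j \<in> J \<Longrightarrow> smooth (f j)"
  shows "dpart l (\<lambda>x. \<Sum>j\<in>J. c j * f j x) = (\<lambda>x. \<Sum>j\<in>J. c j * dpart l (f j) x)"
proof (induction l)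
  case (Cons i l)
  have "partial i (\<lambda>x. \<Sum>j\<in>J. c j * dpart l (f j) x) = (\<lambda>x. \<Sum>j\<in>J. c j * partial i (dpart l (f j)) x)"
    by (rule partial_eqI) (intro DERIV_sum DERIV_cmult smooth_has_partial0 smooth_dpart assms)
  then show ?case using Cons by simp
qed simp

text \<open>Each differentiation contributes one factor \<open>m\<close>. For the cell bumps this is
  the factor \<open>M\<close> per derivative behind all the rates.\<close>

lemma dpart_affine:
  fixes f :: "real^'n \<Rightarrow> real" and c :: "real^'n" and m :: real
  assumes "smooth f"
  shows "dpart l (\<lambda>x. f (m *\<^sub>R x + c)) = (\<lambda>x. m ^ length l * dpart l f (m *\<^sub>R x + c))"
proof (induction l)
  case (Cons i l)
  have "partial i (\<lambda>x. m ^ length l * dpart l f (m *\<^sub>R x + c)) =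
     (\<lambda>x. m ^ length l * (partial i (dpart l f) (m *\<^sub>R x + c) * m))"
  proof (rule partial_eqI, rule DERIV_cmult)
    fix x
    have "((\<lambda>t. t * m) has_real_derivative m) (at 0)" by (auto intro!: derivative_eq_intros)
    from DERIV_chain2[OF _ this, of "\<lambda>t. dpart l f ((m *\<^sub>R x + c) + t *\<^sub>R axis i 1)"
        "partial i (dpart l f) (m *\<^sub>R x + c)"]
    show "((\<lambda>t. dpart l f (m *\<^sub>R (x + t *\<^sub>R axis i 1) + c)) has_real_derivative
        partial i (dpart l f) (m *\<^sub>R x + c) * m) (at 0)"
      using smooth_has_partial0[OF smooth_dpart[OF assms], of l "m *\<^sub>R x + c" i]
      by (simp add: algebra_simps)
  qed
  then show ?case using Cons by (simp add: mult_ac)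
qed simp

text \<open>The complement of the closed support is open, so the function vanishes on a whole
  segment around the point, and so does each further partial.\<close>

lemma dpart_eq_0_off_support:
  assumes "x \<notin> closure {x. f x \<noteq> 0}"
  shows "dpart l f x = 0"
  using assms
proof (induction l arbitrary: x)
  case Nil
  then show ?case using closure_subset[of "{x. f x \<noteq> 0}"] by auto
next
  case (Cons i l)
  let ?S = "- closure {x. f x \<noteq> 0}"
  have "open ((\<lambda>t. x + t *\<^sub>R axis i 1) -` ?S)"
    by (intro open_vimage) (auto intro!: continuous_intros)
  moreover have "0 \<in> (\<lambda>t. x + t *\<^sub>R axis i 1) -` ?S" using Cons.prems by simp
  ultimately have "((\<lambda>t. dpart l f (x + t *\<^sub>R axis i 1)) has_real_derivative 0) (at 0)"
    by (intro has_field_derivative_transform_within_open[OF DERIV_const]) (use Cons.IH in auto)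
  then show ?case by (simp add: partial_def DERIV_imp_deriv)
qed

subsection \<open>Integration by parts and weak derivatives\<close>

lemma Omega_eq_cbox: "(Omega :: (real^'n) set) = cbox 0 1"
  by (auto simp: Omega_def mem_box_cart)

lemma interior_Omega: "interior (Omega :: (real^'n) set) = box 0 1"
  by (simp add: Omega_eq_cbox interior_cbox)

lemma sets_Omega [measurable]: "Omega \<in> sets borel"
  by (simp add: Omega_eq_cbox)

lemma compact_Omega: "compact Omega"
  by (simp add: Omega_eq_cbox compact_cbox)

lemma emeasure_Omega: "emeasure lborel (Omega :: (real^'n) set) = 1"
proof -
  have *: "(1 :: real^'n) \<bullet> b = 1" if "b \<in> Basis" for b
    using that by (auto simp: Basis_vec_def inner_axis)
  then show ?thesis by (simp add: Omega_eq_cbox emeasure_lborel_cbox_eq)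
qed

lemma AE_interior_Omega: "AE x in lborel. x \<in> (Omega :: (real^'n) set) \<longleftrightarrow> x \<in> box 0 1"
proof -
  have "emeasure lborel (cbox 0 1 - box 0 1 :: (real^'n) set) = 0"
    using emeasure_Omega[where 'n='n]
    by (subst emeasure_Diff)
       (auto simp: Omega_eq_cbox box_subset_cbox emeasure_lborel_cbox_eq emeasure_lborel_box_eq)
  then show ?thesis
    by (intro AE_I[where N = "cbox 0 1 - box 0 1"])
       (use box_subset_cbox in \<open>auto simp: Omega_eq_cbox\<close>)
qed

lemma integrable_compact_support:
  fixes f :: "'a::euclidean_space \<Rightarrow> real"
  assumes "continuous_on UNIV f" "compact K" "\<And>x. x \<notin> K \<Longrightarrow> f x = 0"
  shows "integrable lborel f"
proof -
  have "integrable lborel (\<lambda>x. indicator K x *\<^sub>R f x)"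
    by (rule borel_integrable_compact) (use assms in \<open>auto intro: continuous_on_subset\<close>)
  also have "(\<lambda>x. indicator K x *\<^sub>R f x) = f"
    using assms(3) by (auto simp: indicator_def fun_eq_iff)
  finally show ?thesis .
qed

lemma bounded_compact_support:
  fixes f :: "'a::euclidean_space \<Rightarrow> real"
  assumes "continuous_on UNIV f" "compact K" "\<And>x. x \<notin> K \<Longrightarrow> f x = 0"
  obtains C where "C > 0" "\<And>x. \<bar>f x\<bar> \<le> C"
proof -
  have "compact (f ` K)"
    using assms by (auto intro: compact_continuous_image continuous_on_subset)
  then obtain C where "\<And>x. x \<in> K \<Longrightarrow> \<bar>f x\<bar> \<le> C"
    using compact_imp_bounded bounded_real by fastforce
  then have "\<bar>f x\<bar> \<le> max 1 C" for x
    using assms(3)[of x] by (cases "x \<in> K") (auto simp: le_max_iff_disj)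
  then show thesis using that[of "max 1 C"] by simp
qed

text \<open>Every difference quotient of \<open>f\<close> has integral 0 by translation invariance
  of Lebesgue measure; dominated convergence passes to the derivative.\<close>

lemma integral_partial_eq_0:
  fixes f :: "real^'n \<Rightarrow> real"
  assumes f: "continuous_on UNIV f" and g: "continuous_on UNIV g"
    and D: "\<And>x t. ((\<lambda>t. f (x + t *\<^sub>R axis i 1)) has_real_derivative g (x + t *\<^sub>R axis i 1)) (at t)"
    and K: "compact K" "\<And>x. x \<notin> K \<Longrightarrow> f x = 0" "\<And>x. x \<notin> K \<Longrightarrow> g x = 0"
  shows "integral\<^sup>L lborel g = 0"
proof -
  define h :: "nat \<Rightarrow> real" where "h n = 1 / real (Suc n)" for n
  have h: "0 < h n" "h n \<le> 1" for n by (auto simp: h_def)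
  define q where "q n x = (f (x + h n *\<^sub>R axis i 1) - f x) / h n" for n x
  obtain r where r: "K \<subseteq> cball 0 r"
    using compact_imp_bounded[OF K(1)] bounded_subset_ballD[of K 0] ball_subset_cball by (meson order_trans)
  obtain C where C: "C > 0" "\<And>x. \<bar>g x\<bar> \<le> C" using bounded_compact_support[OF g K(1,3)] by blast
  have intf: "integrable lborel f" by (rule integrable_compact_support[OF f K(1,2)])
  have [measurable]: "f \<in> borel_measurable borel" "g \<in> borel_measurable borel"
    using f g by (auto intro: borel_measurable_continuous_onI)
  \<comment> \<open>On the enlarged ball the mean value theorem bounds the quotient by
    \<open>C\<close>. Outside it, both \<open>x\<close> and its shift by at most 1 miss
    \<open>K\<close>, which lies in the ball of radius \<open>r\<close>.\<close>
  have qb: "norm (q n x) \<le> C * indicator (cball 0 (r + 1)) x" for n x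
  proof (cases "x \<in> cball 0 (r + 1)")
    case True
    obtain z where "f (x + h n *\<^sub>R axis i 1) - f (x + 0 *\<^sub>R axis i 1) = (h n - 0) * g (x + z *\<^sub>R axis i 1)"
      using MVT2[OF h(1), where f = "\<lambda>t. f (x + t *\<^sub>R axis i 1)" and f' = "\<lambda>t. g (x + t *\<^sub>R axis i 1)"]
        D by blast
    then have "q n x = g (x + z *\<^sub>R axis i 1)" using h(1)[of n] by (simp add: q_def)
    then show ?thesis using C(2) True by simp
  next
    case False
    then have "x \<notin> K" "x + h n *\<^sub>R axis i 1 \<notin> K"
      using r h[of n] norm_triangle_ineq4[of "x + h n *\<^sub>R axis i 1" "h n *\<^sub>R axis i 1"]
      by (auto simp: norm_axis_1 subset_iff)
    then show ?thesis using False by (simp add: q_def K)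
  qed
  have q0: "integral\<^sup>L lborel (q n) = 0" for n
  proof -
    let ?T = "\<lambda>x. h n *\<^sub>R axis i 1 + x :: real^'n"
    have T: "distr lborel borel ?T = lborel" by (rule lborel_distr_plus)
    have "integral\<^sup>L (distr lborel borel ?T) f = integral\<^sup>L lborel (\<lambda>x. f (?T x))"
      by (rule integral_distr) auto
    moreover have "integrable lborel (\<lambda>x. f (?T x))"
      using intf by (subst (asm) T[symmetric], subst (asm) integrable_distr_eq) auto
    ultimately show ?thesis
      using intf unfolding q_def[abs_def] T by (simp add: add.commute)
  qed
  have "(\<lambda>n. q n x) \<longlonglongrightarrow> g x" for x
  proof -
    have "((\<lambda>t. (f (x + t *\<^sub>R axis i 1) - f x) / t) \<longlongrightarrow> g x) (at 0)"
      using D[of x 0] by (simp add: has_field_derivative_iff)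
    moreover have "filterlim h (at 0) sequentially"
      unfolding h_def using LIMSEQ_Suc[OF lim_1_over_n[where 'a=real]]
      by (auto simp: filterlim_at h_def intro!: always_eventually)
    ultimately show ?thesis unfolding q_def by (rule filterlim_compose)
  qed
  moreover have "integrable lborel (\<lambda>x. C * indicator (cball 0 (r + 1)) x :: real)"
    by (intro integrable_mult_right integrable_real_indicator emeasure_bounded_finite) auto
  moreover have "q n \<in> borel_measurable lborel" for n
    unfolding q_def by measurable
  ultimately have "(\<lambda>n. integral\<^sup>L lborel (q n)) \<longlonglongrightarrow> integral\<^sup>L lborel g"
    by (intro integral_dominated_convergence[where w = "\<lambda>x. C * indicator (cball 0 (r + 1)) x"])
       (use qb in auto)
  then show ?thesis by (simp add: q0 LIMSEQ_const_iff)
qed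

lemma integral_by_parts_partial:
  fixes u \<phi> :: "real^'n \<Rightarrow> real"
  assumes u: "smooth u" and \<phi>: "smooth \<phi>" and supp: "compact (closure {x. u x \<noteq> 0})"
  shows "(LINT x|lborel. u x * partial i \<phi> x) = - (LINT x|lborel. partial i u x * \<phi> x)"
proof -
  note c = smooth_continuous[OF u] smooth_continuous[OF \<phi>]
    smooth_continuous[OF smooth_dpart[OF u, of "[i]"], simplified]
    smooth_continuous[OF smooth_dpart[OF \<phi>, of "[i]"], simplified]
  define K where "K = closure {x. u x \<noteq> 0}"
  have 0: "u x = 0" "partial i u x = 0" if "x \<notin> K" for x
    using dpart_eq_0_off_support[of x u "[]"] dpart_eq_0_off_support[of x u "[i]"] that unfolding K_def by simp_all
  have K: "compact K" using supp unfolding K_def .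
  let ?e = "\<lambda>x t. x + t *\<^sub>R axis i (1::real)"
  have cont: "continuous_on UNIV (\<lambda>x. u x * partial i \<phi> x)" "continuous_on UNIV (\<lambda>x. partial i u x * \<phi> x)"
    "continuous_on UNIV (\<lambda>x. u x * \<phi> x)"
    using c by (blast intro: continuous_on_mult)+
  have "((\<lambda>t. u (?e x t) * \<phi> (?e x t)) has_real_derivative
      u (?e x t) * partial i \<phi> (?e x t) + partial i u (?e x t) * \<phi> (?e x t)) (at t)" for x t
  proof (rule DERIV_cong[OF DERIV_mult[OF smooth_has_partial[OF u] smooth_has_partial[OF \<phi>]]])
    show "partial i u (?e x t) * \<phi> (?e x t) + partial i \<phi> (?e x t) * u (?e x t) =
      u (?e x t) * partial i \<phi> (?e x t) + partial i u (?e x t) * \<phi> (?e x t)" by simp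
  qed
  then have "(LINT x|lborel. u x * partial i \<phi> x + partial i u x * \<phi> x) = 0"
    by (rule integral_partial_eq_0[OF cont(3) continuous_on_add[OF cont(1,2)] _ K]) (simp_all add: 0)
  moreover have "integrable lborel (\<lambda>x. u x * partial i \<phi> x)"
    by (rule integrable_compact_support[OF cont(1) K]) (simp add: 0)
  moreover have "integrable lborel (\<lambda>x. partial i u x * \<phi> x)"
    by (rule integrable_compact_support[OF cont(2) K]) (simp add: 0)
  ultimately show ?thesis by simp
qed

text \<open>The outermost partial is moved first and so lands innermost on \<open>u\<close>; the
  list arrives reversed.\<close>

lemma integral_by_parts_dpart:
  fixes u \<phi> :: "real^'n \<Rightarrow> real"
  assumes "smooth u" "smooth \<phi>" "compact (closure {x. u x \<noteq> 0})"
  shows "(LINT x|lborel. u x * dpart l \<phi> x) = (-1) ^ length l * (LINT x|lborel. dpart (rev l) u x * \<phi> x)"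
  using assms
proof (induction l arbitrary: u)
  case (Cons i l)
  have "closure {x. partial i u x \<noteq> 0} \<subseteq> closure {x. u x \<noteq> 0}"
    by (intro closure_minimal) (use dpart_eq_0_off_support[of _ u "[i]"] in auto)
  then have K: "compact (closure {x. partial i u x \<noteq> 0})"
    using Cons.prems(3) by (metis closed_closure compact_Int_closed inf.absorb_iff2)
  have "(LINT x|lborel. u x * dpart (i # l) \<phi> x) = - (LINT x|lborel. partial i u x * dpart l \<phi> x)"
    using integral_by_parts_partial[OF Cons.prems(1) smooth_dpart[OF Cons.prems(2)] Cons.prems(3)] by simp
  also have "\<dots> = - ((-1) ^ length l * (LINT x|lborel. dpart (rev l) (partial i u) x * \<phi> x))"
    using Cons.IH[OF _ Cons.prems(2) K] smooth_dpart[OF Cons.prems(1), of "[i]"] by simp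
  finally show ?case by (simp add: dpart_append)
qed simp

section \<open>Multi-indices realised as lists of directions\<close>

definition lst :: "('n \<Rightarrow> nat) \<Rightarrow> 'n list" where
  "lst \<alpha> = (SOME l. \<forall>i. count_list l i = \<alpha> i)"

lemma ex_list_with_counts:
  fixes \<alpha> :: "'n::finite \<Rightarrow> nat"
  shows "\<exists>l. \<forall>i. count_list l i = \<alpha> i"
proof -
  obtain M where M: "\<And>i. count M i = \<alpha> i"
    using count_Abs_multiset[of \<alpha>] by (metis finite_code)
  obtain l where "mset l = M" using ex_mset by blast
  then have "count_list l i = \<alpha> i" for i using M by (metis count_mset)
  then show ?thesis by blast
qed

lemma count_list_lst: "count_list (lst \<alpha>) i = \<alpha> (i :: 'n::finite)"
  using someI_ex[OF ex_list_with_counts[of \<alpha>]] by (simp add: lst_def)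

lemma length_lst: "length (lst \<alpha>) = sum \<alpha> (UNIV :: 'n::finite set)"
  using sum_count_set[of "lst \<alpha>" UNIV] by (simp add: count_list_lst)

text \<open>Pure derivatives have a constant list, which reversal leaves unchanged. Both the
  Laplacian and the derivative used in the lower bound are of this kind.\<close>

lemma lst_single: "lst (\<lambda>j. if j = i then k else 0) = replicate k (i :: 'n::finite)"
proof (rule replicate_eqI)
  let ?\<alpha> = "\<lambda>j. if j = i then k else 0"
  show "length (lst ?\<alpha>) = k" by (simp add: length_lst)
  show "y = i" if "y \<in> set (lst ?\<alpha>)" for y
    using that count_list_lst[of ?\<alpha> y] by (metis count_list_0_iff)
qed

lemma cderiv_eq: "cderiv \<alpha> f = dpart (lst \<alpha>) f"
  by (simp add: cderiv_def lst_def)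

lemma test_fun_smooth: "test_fun \<phi> \<Longrightarrow> smooth \<phi>"
  by (simp add: test_fun_def)

lemma test_fun_dpart_0:
  assumes "test_fun \<phi>" "x \<notin> box 0 1"
  shows "dpart l \<phi> x = 0"
  using assms dpart_eq_0_off_support[of x \<phi> l] by (auto simp: test_fun_def interior_Omega)

lemma test_fun_dpart_off_Omega:
  assumes "test_fun \<phi>" "x \<notin> Omega"
  shows "dpart l \<phi> x = 0"
  using test_fun_dpart_0[OF assms(1), of x l] assms(2) box_subset_cbox[of 0 1] by (auto simp: Omega_eq_cbox)

lemma L2_continuous:
  fixes g :: "real^'n \<Rightarrow> real"
  assumes "continuous_on UNIV g"
  shows "L2 g"
proof -
  have "integrable lborel (\<lambda>x. indicator Omega x *\<^sub>R (g x)\<^sup>2)"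
    by (intro borel_integrable_compact compact_Omega continuous_intros continuous_on_subset[OF assms]) auto
  then show ?thesis
    using assms by (simp add: L2_def set_integrable_def borel_measurable_continuous_onI)
qed

text \<open>The integrands vanish off \<open>Omega\<close>, so the set integrals are integrals over
  the whole space and integration by parts has no boundary term.\<close>

lemma is_weak_deriv_test_fun:
  fixes u :: "real^'n \<Rightarrow> real"
  assumes "test_fun u"
  shows "is_weak_deriv \<alpha> u (dpart (rev (lst \<alpha>)) u)"
  unfolding is_weak_deriv_def
proof (intro conjI allI impI)
  show "L2 (dpart (rev (lst \<alpha>)) u)"
    by (intro L2_continuous smooth_continuous smooth_dpart test_fun_smooth assms)
  fix \<phi> :: "real^'n \<Rightarrow> real" assume \<phi>: "test_fun \<phi>"
  have "(LINT x:Omega|lborel. u x * cderiv \<alpha> \<phi> x) = (LINT x|lborel. u x * dpart (lst \<alpha>) \<phi> x)"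
    using test_fun_dpart_off_Omega[OF \<phi>] unfolding set_lebesgue_integral_def cderiv_eq
    by (intro Bochner_Integration.integral_cong) (auto simp: indicator_def)
  also have "\<dots> = (-1) ^ length (lst \<alpha>) * (LINT x|lborel. dpart (rev (lst \<alpha>)) u x * \<phi> x)"
    using assms \<phi> by (intro integral_by_parts_dpart) (auto simp: test_fun_def)
  also have "(LINT x|lborel. dpart (rev (lst \<alpha>)) u x * \<phi> x) = (LINT x:Omega|lborel. dpart (rev (lst \<alpha>)) u x * \<phi> x)"
    using test_fun_dpart_off_Omega[OF assms] unfolding set_lebesgue_integral_def
    by (intro Bochner_Integration.integral_cong) (auto simp: indicator_def)
  finally show "(LINT x:Omega|lborel. u x * cderiv \<alpha> \<phi> x) =
    (-1) ^ sum \<alpha> UNIV * (LINT x:Omega|lborel. dpart (rev (lst \<alpha>)) u x * \<phi> x)"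
    by (simp add: length_lst)
qed

subsection \<open>Uniqueness and linearity of weak derivatives\<close>

lemma flat_exp_1_bounds: "0 \<le> flat_exp 1 t" "flat_exp 1 t \<le> 1"
  by (auto simp: flat_exp_def)

lemma flat_exp_1_nonzero_iff: "flat_exp 1 t \<noteq> 0 \<longleftrightarrow> 0 < t"
  by (auto simp: flat_exp_def)

lemma flat_exp_1_scaled_tendsto:
  "(\<lambda>m. flat_exp 1 (real m * y - 1)) \<longlonglongrightarrow> (if 0 < y then 1 else 0)"
proof (cases "0 < y")
  case True
  have lim: "filterlim (\<lambda>m. real m * y - 1) at_top sequentially"
    using filterlim_tendsto_add_at_top[OF tendsto_const[of "-1"]
        filterlim_at_top_mult_tendsto_pos[OF tendsto_const[of y] True filterlim_real_sequentially]]
    by (simp add: add.commute)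
  have "(\<lambda>m. exp (- (inverse (real m * y - 1)))) \<longlonglongrightarrow> exp (- 0)"
    by (intro tendsto_intros filterlim_compose[OF tendsto_inverse_0_at_top lim]
        tendsto_inverse_0_at_top lim)
  moreover have "\<forall>\<^sub>F m in sequentially. exp (- (inverse (real m * y - 1))) = flat_exp 1 (real m * y - 1)"
    using filterlim_at_top_dense[THEN iffD1, OF lim, rule_format, of 0]
    by eventually_elim (simp add: flat_exp_def inverse_eq_divide)
  ultimately show ?thesis using True by (simp add: Lim_transform_eventually)
next
  case False
  then have "real m * y - 1 \<le> 0" for m
    using mult_nonneg_nonpos[of "real m" y] by simp
  then have "flat_exp 1 (real m * y - 1) = 0" for m
    by (simp add: flat_exp_def not_less)
  then show ?thesis using False by simp
qed

text \<open>The shift by 1 keeps the support at distance \<open>1 / m\<close> from the faces of the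
  box, while for growing \<open>m\<close> the values still tend to the indicator of the open
  box.\<close>

definition box_bump :: "real^'n \<Rightarrow> real^'n \<Rightarrow> real \<Rightarrow> real^'n \<Rightarrow> real" where
  "box_bump a b m x = (\<Prod>i\<in>UNIV. flat_exp 1 (m * (x $ i - a $ i) - 1) * flat_exp 1 (m * (b $ i - x $ i) - 1))"

lemma box_bump_flat_alg: "box_bump a b m \<in> flat_alg"
proof -
  have "(\<lambda>x. \<Prod>i\<in>UNIV. flat_exp 1 (m * x $ i + (- m * a $ i - 1)) * flat_exp 1 ((- m) * x $ i + (m * b $ i - 1))) \<in> flat_alg"
    by (intro flat_alg_prod flat_alg.mult flat_alg.flat)
  then show ?thesis by (simp add: box_bump_def[abs_def] algebra_simps)
qed

lemma box_bump_support:
  assumes "0 < m"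
  shows "closure {x. box_bump a b m x \<noteq> 0} \<subseteq> box a b"
proof -
  have "x \<in> cbox (\<chi> i. a $ i + 1 / m) (\<chi> i. b $ i - 1 / m)" if "box_bump a b m x \<noteq> 0" for x
    using that assms by (auto simp: box_bump_def flat_exp_1_nonzero_iff mem_box_cart field_simps less_imp_le)
  then have "closure {x. box_bump a b m x \<noteq> 0} \<subseteq> cbox (\<chi> i. a $ i + 1 / m) (\<chi> i. b $ i - 1 / m)"
    by (intro closure_minimal) auto
  also have "\<dots> \<subseteq> box a b"
  proof
    fix x assume x: "x \<in> cbox (\<chi> i. a $ i + 1 / m) (\<chi> i. b $ i - 1 / m)"
    have "0 < 1 / m" using assms by simp
    moreover have "a $ i + 1 / m \<le> x $ i \<and> x $ i \<le> b $ i - 1 / m" for i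
      using x by (simp add: mem_box_cart)
    ultimately have "a $ i < x $ i \<and> x $ i < b $ i" for i
      by (smt (verit))
    then show "x \<in> box a b" by (simp add: mem_box_cart)
  qed
  finally show ?thesis .
qed

lemma test_funI:
  fixes f :: "real^'n \<Rightarrow> real"
  assumes "smooth f" "closure {x. f x \<noteq> 0} \<subseteq> box 0 1"
  shows "test_fun f"
proof -
  have "bounded (closure {x. f x \<noteq> 0})" using assms(2) bounded_box bounded_subset by blast
  then show ?thesis using assms by (simp add: test_fun_def interior_Omega compact_eq_bounded_closed)
qed

lemma box_bump_test_fun:
  assumes "0 < m" "\<And>i. 0 \<le> a $ i" "\<And>i. b $ i \<le> 1"
  shows "test_fun (box_bump a b m)"
proof (rule test_funI)
  show "smooth (box_bump a b m)" by (rule flat_alg_smooth[OF box_bump_flat_alg])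
  have "box a b \<subseteq> box 0 1" using assms(2,3) unfolding subset_iff mem_box_cart
    by (metis le_less_trans less_le_trans one_index zero_index)
  then show "closure {x. box_bump a b m x \<noteq> 0} \<subseteq> box 0 1"
    using box_bump_support[OF assms(1)] by blast
qed

lemma box_bump_bounds: "0 \<le> box_bump a b m x" "box_bump a b m x \<le> 1"
  unfolding box_bump_def
  by (auto intro!: prod_nonneg prod_le_1 mult_nonneg_nonneg mult_le_one flat_exp_1_bounds)

lemma box_bump_tendsto: "(\<lambda>m. box_bump a b (real m) x) \<longlonglongrightarrow> indicator (box a b) x"
proof -
  have "(\<lambda>m. box_bump a b (real m) x) \<longlonglongrightarrow>
    (\<Prod>i\<in>UNIV. (if 0 < x $ i - a $ i then 1 else 0) * (if 0 < b $ i - x $ i then 1 else 0))"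
    unfolding box_bump_def by (intro tendsto_intros flat_exp_1_scaled_tendsto)
  also have "(\<Prod>i\<in>UNIV. (if 0 < x $ i - a $ i then 1 else 0) * (if 0 < b $ i - x $ i then 1 else 0)) =
     (indicator (box a b) x :: real)"
    by (auto simp: indicator_def mem_box_cart prod_zero_iff intro!: prod.neutral)
  finally show ?thesis .
qed

section \<open>Square-integrable functions and the fundamental lemma\<close>

lemma L2_integrable:
  assumes "L2 g" "L2 h"
  shows "integrable lborel (\<lambda>x. indicator Omega x * (g x * h x))"
proof (rule Bochner_Integration.integrable_bound)
  show "integrable lborel (\<lambda>x. indicator Omega x * (g x)\<^sup>2 + indicator Omega x * (h x)\<^sup>2)"
    using assms by (auto simp: L2_def set_integrable_def)
  have [measurable]: "g \<in> borel_measurable borel" "h \<in> borel_measurable borel" using assms by (auto simp: L2_def)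
  show "(\<lambda>x. indicator Omega x * (g x * h x)) \<in> borel_measurable lborel" by measurable
  have "norm (g x * h x) \<le> norm ((g x)\<^sup>2 + (h x)\<^sup>2)" for x
    using sum_squares_bound[of "\<bar>g x\<bar>" "\<bar>h x\<bar>"] mult_nonneg_nonneg[of "\<bar>g x\<bar>" "\<bar>h x\<bar>"]
    by (simp add: abs_mult del: mult_nonneg_nonneg)
  then show "AE x in lborel. norm (indicator Omega x * (g x * h x)) \<le>
      norm (indicator Omega x * (g x)\<^sup>2 + indicator Omega x * (h x)\<^sup>2)"
    by (auto simp: indicator_def)
qed

lemma L2_const: "L2 (\<lambda>x. c)" by (intro L2_continuous continuous_intros)

lemma L2_add_scaled:
  assumes "L2 g" "L2 h"
  shows "L2 (\<lambda>x. g x + c * h x)"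
proof -
  have "integrable lborel (\<lambda>x. indicator Omega x * (g x * g x) + 2 * c * (indicator Omega x * (g x * h x)) +
      c\<^sup>2 * (indicator Omega x * (h x * h x)))"
    using assms by (intro Bochner_Integration.integrable_add integrable_mult_right L2_integrable)
  also have "(\<lambda>x. indicator Omega x * (g x * g x) + 2 * c * (indicator Omega x * (g x * h x)) +
      c\<^sup>2 * (indicator Omega x * (h x * h x))) = (\<lambda>x. indicator Omega x * (g x + c * h x)\<^sup>2)"
    by (auto simp: power2_eq_square algebra_simps)
  finally show ?thesis using assms by (auto simp: L2_def set_integrable_def)
qed

lemma L2_integrable_cont:
  assumes "L2 g" "continuous_on UNIV h"
  shows "integrable lborel (\<lambda>x. indicator Omega x * (g x * h x))"
  by (rule L2_integrable[OF assms(1) L2_continuous[OF assms(2)]])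

text \<open>Box bumps turn the hypothesis into vanishing integrals over boxes. The positive and
  negative parts of \<open>g\<close> then define finite measures that agree on a generating family
  stable under intersection, so their densities coincide almost everywhere.\<close>

lemma fundamental_lemma:
  fixes g :: "real^'n \<Rightarrow> real"
  assumes g: "L2 g" and 0: "\<And>\<phi>. test_fun \<phi> \<Longrightarrow> (LINT x:Omega|lborel. g x * \<phi> x) = 0"
  shows "AE x in lborel. x \<in> Omega \<longrightarrow> g x = 0"
proof -
  have [measurable]: "g \<in> borel_measurable borel" using g by (simp add: L2_def)
  have ig: "integrable lborel (\<lambda>x. indicator Omega x * g x)"
    using L2_integrable[OF g L2_const[of 1]] by simp
  have box0: "(LINT x|lborel. indicator (box 0 1 \<inter> box a b) x * g x) = 0" for a b :: "real^'n"
  proof -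
    \<comment> \<open>Clipping the corners to the unit cube makes the bumps of the intersected box
      test functions.\<close>
    define a' b' :: "real^'n" where "a' = (\<chi> i. max 0 (a $ i))" and "b' = (\<chi> i. min 1 (b $ i))"
    have eq: "box 0 1 \<inter> box a b = box a' b'"
      by (auto simp: mem_box_cart a'_def b'_def)
    \<comment> \<open>The index \<open>Suc m\<close> keeps the scale positive, as
      \<open>box_bump_test_fun\<close> requires; \<open>|g|\<close> on \<open>Omega\<close>
      dominates.\<close>
    have "(\<lambda>m. LINT x|lborel. indicator Omega x * (g x * box_bump a' b' (real (Suc m)) x)) \<longlonglongrightarrow>
        (LINT x|lborel. indicator Omega x * (g x * indicator (box a' b') x))"
    proof (rule integral_dominated_convergence[where w = "\<lambda>x. norm (indicator Omega x * g x)"])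
      have [measurable]: "box_bump a' b' m \<in> borel_measurable borel" for m
        by (rule smooth_measurable[OF flat_alg_smooth[OF box_bump_flat_alg]])
      show "(\<lambda>x. indicator Omega x * (g x * box_bump a' b' (real (Suc i)) x)) \<in> borel_measurable lborel" for i
        by measurable
      show "AE x in lborel. (\<lambda>m. indicator Omega x * (g x * box_bump a' b' (real (Suc m)) x)) \<longlonglongrightarrow>
          indicator Omega x * (g x * indicator (box a' b') x)"
        by (intro AE_I2 tendsto_intros LIMSEQ_Suc[OF box_bump_tendsto])
      show "AE x in lborel. norm (indicator Omega x * (g x * box_bump a' b' (real (Suc i)) x)) \<le>
          norm (indicator Omega x * g x)" for i
        using box_bump_bounds[of a' b' "real (Suc i)"]
        by (intro AE_I2) (auto simp: abs_mult indicator_def intro!: mult_left_le)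
    qed (use ig in auto)
    moreover have "(LINT x|lborel. indicator Omega x * (g x * box_bump a' b' (real (Suc m)) x)) = 0" for m
      using 0[OF box_bump_test_fun[of "real (Suc m)" a' b']]
      by (simp add: set_lebesgue_integral_def a'_def b'_def)
    ultimately have "(LINT x|lborel. indicator Omega x * (g x * indicator (box a' b') x)) = 0"
      by (simp add: LIMSEQ_const_iff)
    moreover have "indicator Omega x * (g x * indicator (box a' b') x) = indicator (box 0 1 \<inter> box a b) x * g x" for x
      using box_subset_cbox[of "0::real^'n" 1] eq by (auto simp: indicator_def Omega_eq_cbox)
    ultimately show ?thesis by simp
  qed
  define P where "P = (\<lambda>x. indicator (box 0 1) x * max 0 (g x))"
  define N where "N = (\<lambda>x. indicator (box 0 1) x * max 0 (- g x))"
  have [measurable]: "P \<in> borel_measurable borel" "N \<in> borel_measurable borel" unfolding P_def N_def by auto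
  have PN: "integrable lborel P" "integrable lborel N"
    by (rule Bochner_Integration.integrable_bound[OF ig], simp,
        use box_subset_cbox[of "0::real^'n" 1] in \<open>auto simp: P_def N_def Omega_eq_cbox indicator_def\<close>)+
  have "density lborel (\<lambda>x. ennreal (P x)) = density lborel (\<lambda>x. ennreal (N x))"
  proof (rule measure_eqI_generator_eq[where E = "range (\<lambda>(a, b). box a b)" and \<Omega> = UNIV
        and A = "\<lambda>n. box (- real n *\<^sub>R One) (real n *\<^sub>R One)"])
    show "Int_stable (range (\<lambda>(a, b). box a b :: (real^'n) set))"
      by (auto simp: Int_stable_def box_Int_box)
    show "sets (density lborel (\<lambda>x. ennreal (P x))) = sigma_sets UNIV (range (\<lambda>(a, b). box a b))"
      "sets (density lborel (\<lambda>x. ennreal (N x))) = sigma_sets UNIV (range (\<lambda>(a, b). box a b))"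
      by (simp_all add: borel_eq_box)
    show "(\<Union>n. box (- real n *\<^sub>R One) (real n *\<^sub>R One)) = (UNIV :: (real^'n) set)"
      using UN_box_eq_UNIV by auto
    have emD: "emeasure (density lborel (\<lambda>x. ennreal (F x))) X = ennreal (LINT x|lborel. F x * indicator X x)"
      if F: "integrable lborel F" "\<And>x. 0 \<le> F x" and X: "X \<in> sets borel" for F :: "real^'n \<Rightarrow> real" and X
    proof -
      have "emeasure (density lborel (\<lambda>x. ennreal (F x))) X = (\<integral>\<^sup>+x. ennreal (F x * indicator X x) \<partial>lborel)"
        using F X by (subst emeasure_density) (auto intro!: nn_integral_cong split: split_indicator)
      also have "\<dots> = ennreal (LINT x|lborel. F x * indicator X x)"
        using F X by (intro nn_integral_eq_integral integrable_real_mult_indicator) auto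
      finally show ?thesis .
    qed
    have emP: "emeasure (density lborel (\<lambda>x. ennreal (P x))) X = ennreal (LINT x|lborel. P x * indicator X x)"
      and emN: "emeasure (density lborel (\<lambda>x. ennreal (N x))) X = ennreal (LINT x|lborel. N x * indicator X x)"
      if "X \<in> sets borel" for X
      using that PN by (auto simp: emD P_def N_def)
    show "emeasure (density lborel (\<lambda>x. ennreal (P x))) (box (- real n *\<^sub>R One) (real n *\<^sub>R One)) \<noteq> \<infinity>" for n
      by (simp add: emP)
    fix X :: "(real^'n) set" assume "X \<in> range (\<lambda>(a, b). box a b)"
    then obtain a b where X: "X = box a b" by auto
    have iP: "integrable lborel (\<lambda>x. P x * indicator X x)" and iN: "integrable lborel (\<lambda>x. N x * indicator X x)"
      using PN by (auto simp: X intro!: integrable_real_mult_indicator)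
    have "(LINT x|lborel. P x * indicator X x) - (LINT x|lborel. N x * indicator X x) =
       (LINT x|lborel. P x * indicator X x - N x * indicator X x)"
      using iP iN by simp
    also have "\<dots> = (LINT x|lborel. indicator (box 0 1 \<inter> box a b) x * g x)"
      by (intro Bochner_Integration.integral_cong) (auto simp: P_def N_def X indicator_def)
    finally have "(LINT x|lborel. P x * indicator X x) = (LINT x|lborel. N x * indicator X x)"
      using box0 by simp
    then show "emeasure (density lborel (\<lambda>x. ennreal (P x))) X = emeasure (density lborel (\<lambda>x. ennreal (N x))) X"
      by (simp add: emP emN X)
  qed auto
  then have "AE x in lborel. ennreal (P x) = ennreal (N x)"
    by (intro sigma_finite_measure.density_unique[OF sigma_finite_lborel]) auto
  with AE_interior_Omega show ?thesis
    by eventually_elim (auto simp: P_def N_def indicator_def max_def split: if_splits)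
qed

text \<open>\<open>wderiv\<close> is merely some weak derivative, so every fact about it, linearity
  included, is transferred almost everywhere through this lemma.\<close>

lemma is_weak_deriv_unique:
  fixes u :: "real^'n \<Rightarrow> real"
  assumes g: "is_weak_deriv \<alpha> u g" and h: "is_weak_deriv \<alpha> u h"
  shows "AE x in lborel. x \<in> Omega \<longrightarrow> g x = h x"
proof -
  have L: "L2 g" "L2 h" using g h by (auto simp: is_weak_deriv_def)
  have "AE x in lborel. x \<in> Omega \<longrightarrow> g x + (-1) * h x = 0"
  proof (rule fundamental_lemma)
    show "L2 (\<lambda>x. g x + (-1) * h x)" by (intro L2_add_scaled L)
    fix \<phi> :: "real^'n \<Rightarrow> real" assume \<phi>: "test_fun \<phi>"
    have eq: "(LINT x:Omega|lborel. g x * \<phi> x) = (LINT x:Omega|lborel. h x * \<phi> x)"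
      using g h \<phi> by (auto simp: is_weak_deriv_def)
    have "integrable lborel (\<lambda>x. indicator Omega x * (g x * \<phi> x))" "integrable lborel (\<lambda>x. indicator Omega x * (h x * \<phi> x))"
      by (intro L2_integrable_cont L smooth_continuous test_fun_smooth \<phi>)+
    then show "(LINT x:Omega|lborel. (g x + (-1) * h x) * \<phi> x) = 0"
      using eq by (simp add: set_lebesgue_integral_def algebra_simps)
  qed
  then show ?thesis by simp
qed

lemma is_weak_deriv_add_scaled:
  fixes u w :: "real^'n \<Rightarrow> real"
  assumes "L2 u" "L2 w" and g: "is_weak_deriv \<alpha> u g" and h: "is_weak_deriv \<alpha> w h"
  shows "is_weak_deriv \<alpha> (\<lambda>x. u x + c * w x) (\<lambda>x. g x + c * h x)"
  unfolding is_weak_deriv_def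
proof (intro conjI allI impI)
  have L: "L2 g" "L2 h" using g h by (auto simp: is_weak_deriv_def)
  show "L2 (\<lambda>x. g x + c * h x)" by (intro L2_add_scaled L)
  fix \<phi> :: "real^'n \<Rightarrow> real" assume \<phi>: "test_fun \<phi>"
  have lin: "(LINT x:Omega|lborel. (f1 x + c * f2 x) * v x) =
      (LINT x:Omega|lborel. f1 x * v x) + c * (LINT x:Omega|lborel. f2 x * v x)"
    if "L2 f1" "L2 f2" "smooth v" for f1 f2 v :: "real^'n \<Rightarrow> real"
    using L2_integrable_cont[OF that(1) smooth_continuous[OF that(3)]]
      L2_integrable_cont[OF that(2) smooth_continuous[OF that(3)]]
    unfolding set_lebesgue_integral_def by (simp add: algebra_simps)
  have "(LINT x:Omega|lborel. (u x + c * w x) * cderiv \<alpha> \<phi> x) =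
     (LINT x:Omega|lborel. u x * cderiv \<alpha> \<phi> x) + c * (LINT x:Omega|lborel. w x * cderiv \<alpha> \<phi> x)"
    by (intro lin assms) (simp add: cderiv_eq smooth_dpart test_fun_smooth \<phi>)
  also have "\<dots> = (-1) ^ sum \<alpha> UNIV * ((LINT x:Omega|lborel. g x * \<phi> x) + c * (LINT x:Omega|lborel. h x * \<phi> x))"
    using g h \<phi> by (simp add: is_weak_deriv_def algebra_simps)
  also have "\<dots> = (-1) ^ sum \<alpha> UNIV * (LINT x:Omega|lborel. (g x + c * h x) * \<phi> x)"
    by (simp add: lin L test_fun_smooth \<phi>)
  finally show "(LINT x:Omega|lborel. (u x + c * w x) * cderiv \<alpha> \<phi> x) =
     (-1) ^ sum \<alpha> UNIV * (LINT x:Omega|lborel. (g x + c * h x) * \<phi> x)" .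
qed

lemma is_weak_deriv_wderiv:
  "u \<in> Hk k \<Longrightarrow> sum \<alpha> UNIV \<le> k \<Longrightarrow> is_weak_deriv \<alpha> u (wderiv \<alpha> u)"
  unfolding wderiv_def Hk_def by (simp add: someI_ex)

lemma L2_wderiv: "u \<in> Hk k \<Longrightarrow> sum \<alpha> UNIV \<le> k \<Longrightarrow> L2 (wderiv \<alpha> u)"
  using is_weak_deriv_wderiv by (auto simp: is_weak_deriv_def)

lemma Hk_add_scaled:
  assumes "u \<in> Hk k" "w \<in> Hk k"
  shows "(\<lambda>x. u x + c * w x) \<in> Hk k"
  using assms is_weak_deriv_add_scaled L2_add_scaled unfolding Hk_def by blast

lemma wderiv_add_scaled:
  assumes u: "u \<in> Hk k" and w: "w \<in> Hk k" and \<alpha>: "sum \<alpha> UNIV \<le> k"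
  shows "AE x in lborel. x \<in> Omega \<longrightarrow> wderiv \<alpha> (\<lambda>x. u x + c * w x) x = wderiv \<alpha> u x + c * wderiv \<alpha> w x"
  by (rule is_weak_deriv_unique[OF is_weak_deriv_wderiv[OF Hk_add_scaled[OF u w] \<alpha>]
        is_weak_deriv_add_scaled[OF _ _ is_weak_deriv_wderiv[OF u \<alpha>] is_weak_deriv_wderiv[OF w \<alpha>]]])
     (use u w in \<open>auto simp: Hk_def\<close>)

lemma test_fun_Hk: "test_fun u \<Longrightarrow> u \<in> Hk k"
  unfolding Hk_def using is_weak_deriv_test_fun L2_continuous smooth_continuous test_fun_smooth by blast

lemma wderiv_test_fun:
  assumes "test_fun u"
  shows "AE x in lborel. x \<in> Omega \<longrightarrow> wderiv \<alpha> u x = dpart (rev (lst \<alpha>)) u x"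
  by (rule is_weak_deriv_unique[OF is_weak_deriv_wderiv[OF test_fun_Hk[OF assms] order.refl]
        is_weak_deriv_test_fun[OF assms]])

lemma test_fun_zero: "test_fun (\<lambda>x::real^'n. 0)"
  by (rule test_funI) (auto intro: flat_alg_smooth flat_alg.const)

lemma Hk_zero: "(\<lambda>x. 0) \<in> Hk k"
  by (rule test_fun_Hk[OF test_fun_zero])

subsection \<open>Sobolev inner products\<close>

definition ip :: "(real^'n \<Rightarrow> real) \<Rightarrow> (real^'n \<Rightarrow> real) \<Rightarrow> real" where
  "ip g h = (LINT x|lborel. indicator Omega x * (g x * h x))"

lemma ip_commute: "ip g h = ip h g"
  by (simp add: ip_def mult.commute)

lemma ip_nonneg: "0 \<le> ip g g"
  by (simp add: ip_def)

lemma ip_add_scaled_left: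
  assumes "L2 f" "L2 g" "L2 h"
  shows "ip (\<lambda>x. f x + c * g x) h = ip f h + c * ip g h"
  using L2_integrable[OF assms(1,3)] L2_integrable[OF assms(2,3)]
  unfolding ip_def by (simp add: algebra_simps)

lemma ip_add_scaled_self:
  assumes f: "L2 f" and g: "L2 g"
  shows "ip (\<lambda>x. f x + c * g x) (\<lambda>x. f x + c * g x) = ip f f + 2 * c * ip f g + c\<^sup>2 * ip g g"
proof -
  let ?h = "\<lambda>x. f x + c * g x"
  have "ip ?h ?h = ip f ?h + c * ip g ?h"
    by (rule ip_add_scaled_left[OF f g L2_add_scaled[OF f g]])
  also have "ip f ?h = ip f f + c * ip g f"
    using ip_add_scaled_left[OF f g f] ip_commute by metis
  also have "ip g ?h = ip f g + c * ip g g"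
    using ip_add_scaled_left[OF f g g] ip_commute by metis
  finally show ?thesis
    by (simp add: ip_commute[of g f] power2_eq_square algebra_simps)
qed

lemma ip_cong_AE:
  assumes "L2 f" "L2 f'" "L2 g" "L2 g'"
    and "AE x in lborel. x \<in> Omega \<longrightarrow> f x = f' x" "AE x in lborel. x \<in> Omega \<longrightarrow> g x = g' x"
  shows "ip f g = ip f' g'"
  unfolding ip_def
proof (rule integral_cong_AE)
  show "AE x in lborel. indicator Omega x * (f x * g x) = indicator Omega x * (f' x * g' x)"
    using assms(5,6) by eventually_elim (auto simp: indicator_def)
qed (use assms(1-4) in \<open>auto simp: L2_def\<close>)

lemma ip_young:
  assumes "L2 f" "L2 g"
  shows "2 * ip f g \<le> ip f f + ip g g"
  using ip_add_scaled_self[OF assms, of "-1"] ip_nonneg[of "\<lambda>x. f x + (-1) * g x"] by simp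

definition sob_ip :: "nat \<Rightarrow> (real^'n \<Rightarrow> real) \<Rightarrow> (real^'n \<Rightarrow> real) \<Rightarrow> real" where
  "sob_ip k u w = (\<Sum>\<alpha> | sum \<alpha> UNIV \<le> k. ip (wderiv \<alpha> u) (wderiv \<alpha> w))"

lemma finite_multi_indices: "finite {\<alpha> :: 'n::finite \<Rightarrow> nat. sum \<alpha> UNIV \<le> k}"
proof (rule finite_subset)
  show "{\<alpha> :: 'n \<Rightarrow> nat. sum \<alpha> UNIV \<le> k} \<subseteq> PiE UNIV (\<lambda>_. {..k})"
  proof (intro subsetI PiE_I)
    fix \<alpha> :: "'n \<Rightarrow> nat" and i assume "\<alpha> \<in> {\<alpha>. sum \<alpha> UNIV \<le> k}"
    then show "\<alpha> i \<in> {..k}" using member_le_sum[of i UNIV \<alpha>] by simp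
  qed simp
qed (auto intro: finite_PiE)

lemma sob_norm_sq: "(sob_norm k u)\<^sup>2 = sob_ip k u u"
  by (simp add: sob_norm_def sob_ip_def ip_def set_lebesgue_integral_def sum_nonneg power2_eq_square)

lemma ip_wderiv_le_sob_norm: "sum \<alpha> UNIV \<le> k \<Longrightarrow> ip (wderiv \<alpha> u) (wderiv \<alpha> u) \<le> (sob_norm k u)\<^sup>2"
  unfolding sob_norm_sq sob_ip_def by (rule member_le_sum) (auto simp: ip_nonneg finite_multi_indices)

lemma sob_norm_add_scaled:
  assumes u: "u \<in> Hk k" and w: "w \<in> Hk k"
  shows "(sob_norm k (\<lambda>x. u x + c * w x))\<^sup>2 = (sob_norm k u)\<^sup>2 + 2 * c * sob_ip k u w + c\<^sup>2 * (sob_norm k w)\<^sup>2"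
proof -
  have "ip (wderiv \<alpha> (\<lambda>x. u x + c * w x)) (wderiv \<alpha> (\<lambda>x. u x + c * w x)) =
      ip (wderiv \<alpha> u) (wderiv \<alpha> u) + 2 * c * ip (wderiv \<alpha> u) (wderiv \<alpha> w) + c\<^sup>2 * ip (wderiv \<alpha> w) (wderiv \<alpha> w)"
    if \<alpha>: "sum \<alpha> UNIV \<le> k" for \<alpha>
  proof -
    note L = L2_wderiv[OF u \<alpha>] L2_wderiv[OF w \<alpha>] L2_wderiv[OF Hk_add_scaled[OF u w, of c] \<alpha>]
    have "ip (wderiv \<alpha> (\<lambda>x. u x + c * w x)) (wderiv \<alpha> (\<lambda>x. u x + c * w x)) =
      ip (\<lambda>x. wderiv \<alpha> u x + c * wderiv \<alpha> w x) (\<lambda>x. wderiv \<alpha> u x + c * wderiv \<alpha> w x)"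
      by (intro ip_cong_AE wderiv_add_scaled[OF u w \<alpha>] L L2_add_scaled)
    then show ?thesis using ip_add_scaled_self[OF L(1,2)] by simp
  qed
  then show ?thesis
    by (simp add: sob_norm_sq sob_ip_def sum.distrib sum_distrib_left)
qed

lemma ip_wderiv_add_scaled:
  assumes "u \<in> Hk k" "w \<in> Hk k" "sum \<alpha> UNIV \<le> k" "L2 g"
  shows "ip (wderiv \<alpha> (\<lambda>x. u x + c * w x)) g = ip (wderiv \<alpha> u) g + c * ip (wderiv \<alpha> w) g"
proof -
  have "ip (wderiv \<alpha> (\<lambda>x. u x + c * w x)) g = ip (\<lambda>x. wderiv \<alpha> u x + c * wderiv \<alpha> w x) g"
    using assms by (intro ip_cong_AE wderiv_add_scaled L2_add_scaled L2_wderiv Hk_add_scaled) auto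
  then show ?thesis using assms by (simp add: ip_add_scaled_left L2_wderiv)
qed

text \<open>A substitute for the Riesz representation theorem that needs no completeness: the inner products
  with a minimising sequence of \<open>\<parallel>w\<parallel>\<^sup>2 / 2 - \<ell> w\<close> converge pointwise to the functional \<open>\<ell>\<close>.\<close>

lemma riesz_sequence:
  fixes g :: "real^'n \<Rightarrow> real"
  assumes g: "L2 g" and \<alpha>: "sum \<alpha> UNIV \<le> k"
  obtains w where "\<And>m. w m \<in> Hk k" "\<And>u. u \<in> Hk k \<Longrightarrow> (\<lambda>m. sob_ip k (w m) u) \<longlonglongrightarrow> ip (wderiv \<alpha> u) g"
proof -
  define J where "J w = (sob_norm k w)\<^sup>2 / 2 - ip (wderiv \<alpha> w) g" for w
  \<comment> \<open>The Sobolev norm dominates the single term for \<open>\<alpha>\<close>, and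
    Young's inequality absorbs the linear part into it: \<open>J\<close> is bounded below.\<close>
  have "- ip g g / 2 \<le> J w" if "w \<in> Hk k" for w
    using ip_young[OF L2_wderiv[OF that \<alpha>] g] ip_wderiv_le_sob_norm[OF \<alpha>, of w] by (simp add: J_def)
  then have bdd: "bdd_below (J ` Hk k)" by (auto intro!: bdd_belowI)
  have ne: "J ` Hk k \<noteq> {}" using Hk_zero by blast
  have "\<exists>w. w \<in> Hk k \<and> J w < Inf (J ` Hk k) + 1 / real (Suc m)" for m
    using cInf_lessD[OF ne, of "Inf (J ` Hk k) + 1 / real (Suc m)"] by auto
  then obtain w where w: "\<And>m. w m \<in> Hk k" "\<And>m. J (w m) < Inf (J ` Hk k) + 1 / real (Suc m)"
    by metis
  have "(\<lambda>m. sob_ip k (w m) u) \<longlonglongrightarrow> ip (wderiv \<alpha> u) g" if u: "u \<in> Hk k" for u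
  proof -
    define q where "q = (sob_norm k u)\<^sup>2"
    \<comment> \<open>The derivative of \<open>J\<close> at \<open>w m\<close> in direction
      \<open>u\<close>; near a minimum it has to be small.\<close>
    define b where "b m = sob_ip k (w m) u - ip (wderiv \<alpha> u) g" for m
    have q: "0 \<le> q" by (simp add: q_def)
    have bound: "(b m)\<^sup>2 \<le> 2 * (q + 1) * (1 / real (Suc m))" for m
    proof -
      \<comment> \<open>The parabola \<open>t b + t^2 q / 2\<close> is lowest at
        \<open>-b / q\<close>; the denominator \<open>q + 1\<close> is almost as good and never
        zero.\<close>
      define t where "t = - b m / (q + 1)"
      define p where "p = (b m)\<^sup>2 / (q + 1)"
      have "Inf (J ` Hk k) \<le> J (\<lambda>x. w m x + t * u x)"
        using bdd Hk_add_scaled[OF w(1) u] by (intro cInf_lower) auto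
      also have "\<dots> = J (w m) + t * b m + t\<^sup>2 * q / 2"
        unfolding J_def b_def q_def sob_norm_add_scaled[OF w(1) u] ip_wderiv_add_scaled[OF w(1) u \<alpha> g]
        by (simp add: algebra_simps add_divide_distrib)
      finally have "0 \<le> 1 / real (Suc m) + t * b m + t\<^sup>2 * q / 2"
        using w(2)[of m] by linarith
      moreover have "t\<^sup>2 * q \<le> p"
      proof -
        have "t\<^sup>2 * q \<le> t\<^sup>2 * (q + 1)" by (simp add: mult_left_mono)
        also have "\<dots> = p"
          using q by (simp add: p_def t_def power_divide power2_eq_square)
        finally show ?thesis .
      qed
      moreover have "t * b m = - p"
        using q by (simp add: t_def p_def power2_eq_square)
      ultimately have "p \<le> 2 * (1 / real (Suc m))" by linarith
      then have "p * (q + 1) \<le> 2 * (1 / real (Suc m)) * (q + 1)"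
        using q by (intro mult_right_mono) auto
      then show ?thesis using q by (simp add: p_def mult_ac)
    qed
    have "(\<lambda>m. (b m)\<^sup>2) \<longlonglongrightarrow> 0"
    proof (rule tendsto_sandwich[OF _ _ tendsto_const])
      show "(\<lambda>m. 2 * (q + 1) * (1 / real (Suc m))) \<longlonglongrightarrow> 0"
        using tendsto_mult_right_zero[OF LIMSEQ_Suc[OF lim_1_over_n[where 'a=real]]] by simp
    qed (use bound in auto)
    from tendsto_real_sqrt[OF this] have "b \<longlonglongrightarrow> 0"
      by (simp add: tendsto_rabs_zero_iff)
    then show ?thesis
      using tendsto_add[of b 0 sequentially "\<lambda>_. ip (wderiv \<alpha> u) g"] by (simp add: b_def[abs_def])
  qed
  then show thesis using that w(1) by blast
qed

lemma sob_ip_commute: "sob_ip k u w = sob_ip k w u"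
  by (simp add: sob_ip_def ip_commute)

text \<open>Polarisation expresses the inner product of \<open>\<psi> \<omega>\<close> with a fixed
  \<open>w\<close> by distances, which \<open>estimator\<close> makes measurable;
  \<open>riesz_sequence\<close> presents the functional as a pointwise limit of such inner
  products.\<close>

lemma estimator_functional_measurable:
  fixes g :: "real^'n \<Rightarrow> real"
  assumes \<psi>: "estimator s n \<psi>" and g: "L2 g" and \<alpha>: "sum \<alpha> UNIV \<le> s"
  shows "(\<lambda>\<omega>. ip (wderiv \<alpha> (\<psi> \<omega>)) g) \<in> borel_measurable (PiM {..<n} (\<lambda>_. borel))"
    (is "_ \<in> borel_measurable ?M")
proof -
  obtain w where w: "\<And>m. w m \<in> Hk s" "\<And>u. u \<in> Hk s \<Longrightarrow> (\<lambda>m. sob_ip s (w m) u) \<longlonglongrightarrow> ip (wderiv \<alpha> u) g"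
    using riesz_sequence[OF g \<alpha>] by blast
  have H: "\<psi> \<omega> \<in> Hk s" if "\<omega> \<in> space ?M" for \<omega>
    using \<psi> that by (auto simp: estimator_def)
  have M: "(\<lambda>\<omega>. sob_norm s (\<lambda>x. \<psi> \<omega> x - v x)) \<in> borel_measurable ?M" if "v \<in> Hk s" for v
    using \<psi> that by (auto simp: estimator_def)
  have [measurable]: "(\<lambda>\<omega>. sob_ip s (w m) (\<psi> \<omega>)) \<in> borel_measurable ?M" for m
  proof -
    \<comment> \<open>The norm of \<open>\<psi> \<omega>\<close> is its distance to the zero
      function, a point of \<open>Hk s\<close>; hence the form \<open>x - 0\<close>.\<close>
    have "sob_ip s (w m) (\<psi> \<omega>) = ((sob_norm s (\<lambda>x. \<psi> \<omega> x - 0))\<^sup>2 + (sob_norm s (w m))\<^sup>2 -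
        (sob_norm s (\<lambda>x. \<psi> \<omega> x - w m x))\<^sup>2) / 2" if "\<omega> \<in> space ?M" for \<omega>
      using sob_norm_add_scaled[OF H[OF that] w(1), of "-1" m] by (simp add: sob_ip_commute)
    moreover have "(\<lambda>\<omega>. ((sob_norm s (\<lambda>x. \<psi> \<omega> x - 0))\<^sup>2 + (sob_norm s (w m))\<^sup>2 -
        (sob_norm s (\<lambda>x. \<psi> \<omega> x - w m x))\<^sup>2) / 2) \<in> borel_measurable ?M"
      using M[OF Hk_zero] M[OF w(1)] by measurable
    ultimately show ?thesis by (rule measurable_cong[THEN iffD2])
  qed
  show ?thesis
  proof (rule borel_measurable_LIMSEQ_real)
    show "(\<lambda>m. sob_ip s (w m) (\<psi> \<omega>)) \<longlonglongrightarrow> ip (wderiv \<alpha> (\<psi> \<omega>)) g" if "\<omega> \<in> space ?M" for \<omega>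
      by (rule w(2)[OF H[OF that]])
  qed measurable
qed

subsection \<open>Testing two product measures, and Assouad's method\<close>

text \<open>Minimising the first two terms over \<open>T\<close> leaves
  \<open>4 N^2 a b / (a + b)\<close>; the inequality is then the AM-GM inequality for this quantity
  and \<open>N^2 (a + b) / 4\<close>. The proof writes the slack as a sum of two squares.\<close>

lemma two_point_pointwise:
  fixes T N a b :: real
  assumes "0 \<le> a" "0 \<le> b"
  shows "2 * N\<^sup>2 * sqrt (a * b) \<le> (T - N)\<^sup>2 * a + (T + N)\<^sup>2 * b + N\<^sup>2 / 4 * (a + b)"
proof (cases "a + b = 0")
  case True
  then have "a = 0" "b = 0" using assms by auto
  then show ?thesis by simp
next
  case False
  define s r where "s = sqrt a" and "r = sqrt b"
  have ab: "a = s\<^sup>2" "b = r\<^sup>2" and sq: "sqrt (a * b) = s * r"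
    using assms by (auto simp: s_def r_def real_sqrt_mult)
  let ?E = "(T - N)\<^sup>2 * a + (T + N)\<^sup>2 * b + N\<^sup>2 / 4 * (a + b) - 2 * N\<^sup>2 * (s * r)"
  have "(a + b) * ?E = ((a + b) * T - N * (a - b))\<^sup>2 + N\<^sup>2 * ((a + b) / 2 - 2 * (s * r))\<^sup>2"
    unfolding ab by (simp add: power2_eq_square field_simps)
  also have "\<dots> \<ge> 0" by simp
  finally have "0 \<le> ?E" using False assms by (simp add: zero_le_mult_iff)
  then show ?thesis by (simp add: sq)
qed

text \<open>It suffices to compare both measures on rectangles, where the integral of a product of
  one-coordinate functions factorises.\<close>

lemma PiM_density:
  fixes f :: "'a \<Rightarrow> ennreal" and I :: "'i set"
  assumes M: "sigma_finite_measure M" and fin: "finite I" and f [measurable]: "f \<in> borel_measurable M"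
    and D: "sigma_finite_measure (density M f)"
  shows "PiM I (\<lambda>_. density M f) = density (PiM I (\<lambda>_. M)) (\<lambda>\<omega>. \<Prod>i\<in>I. f (\<omega> i))"
proof -
  interpret P: product_sigma_finite "\<lambda>_::'i. M" using M by (simp add: product_sigma_finite_def)
  interpret Q: product_sigma_finite "\<lambda>_::'i. density M f" using D by (simp add: product_sigma_finite_def)
  have [measurable]: "(\<lambda>\<omega>. \<Prod>i\<in>I. f (\<omega> i)) \<in> borel_measurable (PiM I (\<lambda>_. M))"
    by measurable
  show ?thesis
  proof (rule Q.PiM_eqI[OF fin, symmetric])
    show "sets (density (PiM I (\<lambda>_. M)) (\<lambda>\<omega>. \<Prod>i\<in>I. f (\<omega> i))) = sets (PiM I (\<lambda>_. density M f))"
      by (simp, rule sets_PiM_cong) auto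
    fix A :: "'i \<Rightarrow> 'a set" assume "\<And>i. i \<in> I \<Longrightarrow> A i \<in> sets (density M f)"
    then have A: "\<And>i. i \<in> I \<Longrightarrow> A i \<in> sets M" by simp
    have "emeasure (density (PiM I (\<lambda>_. M)) (\<lambda>\<omega>. \<Prod>i\<in>I. f (\<omega> i))) (Pi\<^sub>E I A) =
       (\<integral>\<^sup>+\<omega>. (\<Prod>i\<in>I. f (\<omega> i)) * indicator (Pi\<^sub>E I A) \<omega> \<partial>PiM I (\<lambda>_. M))"
      using A fin by (intro emeasure_density sets_PiM_I_finite) auto
    also have "\<dots> = (\<integral>\<^sup>+\<omega>. (\<Prod>i\<in>I. f (\<omega> i) * indicator (A i) (\<omega> i)) \<partial>PiM I (\<lambda>_. M))"
    proof (rule nn_integral_cong)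
      fix \<omega> assume "\<omega> \<in> space (PiM I (\<lambda>_. M))"
      then have "(indicator (Pi\<^sub>E I A) \<omega> :: ennreal) = (\<Prod>i\<in>I. indicator (A i) (\<omega> i))"
        using fin by (auto simp: indicator_def space_PiM PiE_iff prod_zero_iff)
      then show "(\<Prod>i\<in>I. f (\<omega> i)) * indicator (Pi\<^sub>E I A) \<omega> = (\<Prod>i\<in>I. f (\<omega> i) * indicator (A i) (\<omega> i))"
        by (simp add: prod.distrib)
    qed
    also have "\<dots> = (\<Prod>i\<in>I. \<integral>\<^sup>+x. f x * indicator (A i) x \<partial>M)"
      using A fin by (intro P.product_nn_integral_prod) auto
    also have "\<dots> = (\<Prod>i\<in>I. emeasure (density M f) (A i))"
      using A by (intro prod.cong refl) (simp add: emeasure_density)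
    finally show "emeasure (density (PiM I (\<lambda>_. M)) (\<lambda>\<omega>. \<Prod>i\<in>I. f (\<omega> i))) (Pi\<^sub>E I A) =
      (\<Prod>i\<in>I. emeasure (density M f) (A i))" .
  qed
qed

text \<open>Le Cam's two-point bound for squared error: the pointwise inequality is integrated with
  \<open>a\<close>, \<open>b\<close> the two product densities, and the affinity of products is the
  product of the affinities.\<close>

lemma two_point_product:
  fixes p q :: "'a \<Rightarrow> real" and T :: "(nat \<Rightarrow> 'a) \<Rightarrow> real"
  assumes M: "sigma_finite_measure M"
    and p [measurable]: "p \<in> borel_measurable M" and q [measurable]: "q \<in> borel_measurable M"
    and p0: "\<And>x. 0 \<le> p x" and q0: "\<And>x. 0 \<le> q x"
    and p1: "(\<integral>\<^sup>+x. p x \<partial>M) = 1" and q1: "(\<integral>\<^sup>+x. q x \<partial>M) = 1"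
    and aff: "ennreal (1 - 1 / (2 * real n)) \<le> (\<integral>\<^sup>+x. sqrt (p x * q x) \<partial>M)" and n: "1 \<le> n"
    and T [measurable]: "T \<in> borel_measurable (PiM {..<n} (\<lambda>_. M))"
  shows "ennreal (N\<^sup>2 / 2) \<le> (\<integral>\<^sup>+\<omega>. (T \<omega> - N)\<^sup>2 \<partial>PiM {..<n} (\<lambda>_. density M p)) +
    (\<integral>\<^sup>+\<omega>. (T \<omega> + N)\<^sup>2 \<partial>PiM {..<n} (\<lambda>_. density M q))"
proof -
  let ?P = "PiM {..<n} (\<lambda>_. M)"
  interpret P: product_sigma_finite "\<lambda>_::nat. M" using M by (simp add: product_sigma_finite_def)
  have sf: "sigma_finite_measure (density M h)" if "h \<in> borel_measurable M" "(\<integral>\<^sup>+x. h x \<partial>M) = 1" for h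
  proof -
    have "prob_space (density M h)"
      using that by (intro prob_spaceI) (simp add: emeasure_density cong: nn_integral_cong)
    then show ?thesis using prob_space_imp_sigma_finite by blast
  qed
  define pn where "pn \<omega> = (\<Prod>i<n. p (\<omega> i))" for \<omega>
  define qn where "qn \<omega> = (\<Prod>i<n. q (\<omega> i))" for \<omega>
  have pn0: "0 \<le> pn \<omega>" and qn0: "0 \<le> qn \<omega>" for \<omega>
    by (auto simp: pn_def qn_def p0 q0 prod_nonneg)
  have [measurable]: "pn \<in> borel_measurable ?P" "qn \<in> borel_measurable ?P"
    unfolding pn_def qn_def by measurable
  have Pp: "PiM {..<n} (\<lambda>_. density M p) = density ?P pn"
    using PiM_density[OF M, of "{..<n}" p] sf p1 by (simp add: pn_def prod_ennreal p0)
  have Pq: "PiM {..<n} (\<lambda>_. density M q) = density ?P qn"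
    using PiM_density[OF M, of "{..<n}" q] sf q1 by (simp add: qn_def prod_ennreal q0)
  have pn1: "(\<integral>\<^sup>+\<omega>. pn \<omega> \<partial>?P) = 1" and qn1: "(\<integral>\<^sup>+\<omega>. qn \<omega> \<partial>?P) = 1"
    using P.product_nn_integral_prod[of "{..<n}" "\<lambda>_. p"] P.product_nn_integral_prod[of "{..<n}" "\<lambda>_. q"] p1 q1
    by (auto simp: pn_def qn_def prod_ennreal p0 q0)
  \<comment> \<open>Bernoulli's inequality: an affinity loss of \<open>1 / (2 n)\<close> per
    observation leaves at least 1/2 after \<open>n\<close> observations.\<close>
  have "ennreal (1 / 2) \<le> ennreal ((1 - 1 / (2 * real n)) ^ n)"
    using Bernoulli_inequality[of "- 1 / (2 * real n)" n] n by (intro ennreal_leI) (simp add: field_simps)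
  also have "\<dots> = ennreal (1 - 1 / (2 * real n)) ^ n"
    using n by (intro ennreal_power[symmetric]) (simp add: field_simps)
  also have "\<dots> \<le> (\<integral>\<^sup>+x. sqrt (p x * q x) \<partial>M) ^ n"
    using aff by (intro power_mono) auto
  also have "\<dots> = (\<integral>\<^sup>+\<omega>. (\<Prod>i<n. ennreal (sqrt (p (\<omega> i) * q (\<omega> i)))) \<partial>?P)"
    by (subst P.product_nn_integral_prod) auto
  also have "\<dots> = (\<integral>\<^sup>+\<omega>. sqrt (pn \<omega> * qn \<omega>) \<partial>?P)"
  proof -
    have "(\<Prod>i<m. sqrt (p (\<omega> i) * q (\<omega> i))) = sqrt ((\<Prod>i<m. p (\<omega> i)) * (\<Prod>i<m. q (\<omega> i)))" for m :: nat and \<omega>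
      by (induction m) (auto simp: real_sqrt_mult)
    then show ?thesis by (simp add: prod_ennreal p0 q0 pn_def qn_def)
  qed
  finally have aff': "ennreal (1 / 2) \<le> (\<integral>\<^sup>+\<omega>. sqrt (pn \<omega> * qn \<omega>) \<partial>?P)" .
  let ?X = "\<integral>\<^sup>+\<omega>. (T \<omega> - N)\<^sup>2 \<partial>PiM {..<n} (\<lambda>_. density M p)"
  let ?Y = "\<integral>\<^sup>+\<omega>. (T \<omega> + N)\<^sup>2 \<partial>PiM {..<n} (\<lambda>_. density M q)"
  have X: "?X = (\<integral>\<^sup>+\<omega>. (T \<omega> - N)\<^sup>2 * pn \<omega> \<partial>?P)"
    unfolding Pp by (subst nn_integral_density) (auto simp: pn0 ennreal_mult' mult.commute)
  have Y: "?Y = (\<integral>\<^sup>+\<omega>. (T \<omega> + N)\<^sup>2 * qn \<omega> \<partial>?P)"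
    unfolding Pq by (subst nn_integral_density) (auto simp: qn0 ennreal_mult' mult.commute)
  \<comment> \<open>Both densities have mass 1, so the third term of the pointwise inequality costs
    exactly \<open>N^2 / 2\<close>, half of the gain \<open>N^2\<close>.\<close>
  have Z: "(\<integral>\<^sup>+\<omega>. N\<^sup>2 / 4 * (pn \<omega> + qn \<omega>) \<partial>?P) = ennreal (N\<^sup>2 / 2)"
  proof -
    have "(\<integral>\<^sup>+\<omega>. N\<^sup>2 / 4 * (pn \<omega> + qn \<omega>) \<partial>?P) = ennreal (N\<^sup>2 / 4) * ((\<integral>\<^sup>+\<omega>. pn \<omega> \<partial>?P) + (\<integral>\<^sup>+\<omega>. qn \<omega> \<partial>?P))"
    proof -
      have "ennreal (N\<^sup>2 / 4 * (pn \<omega> + qn \<omega>)) = ennreal (N\<^sup>2 / 4) * (ennreal (pn \<omega>) + ennreal (qn \<omega>))" for \<omega>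
        by (subst ennreal_mult) (auto simp: pn0 qn0)
      then show ?thesis by (simp only:) (simp add: nn_integral_cmult nn_integral_add)
    qed
    also have "\<dots> = ennreal (N\<^sup>2 / 4) * ennreal 2" by (simp add: pn1 qn1)
    also have "\<dots> = ennreal (N\<^sup>2 / 2)" by (subst ennreal_mult[symmetric]) auto
    finally show ?thesis .
  qed
  have "ennreal (N\<^sup>2) = ennreal (2 * N\<^sup>2) * ennreal (1 / 2)" by (subst ennreal_mult[symmetric]) auto
  also have "\<dots> \<le> ennreal (2 * N\<^sup>2) * (\<integral>\<^sup>+\<omega>. sqrt (pn \<omega> * qn \<omega>) \<partial>?P)"
    by (intro mult_left_mono aff') auto
  also have "\<dots> = (\<integral>\<^sup>+\<omega>. 2 * N\<^sup>2 * sqrt (pn \<omega> * qn \<omega>) \<partial>?P)"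
    by (subst nn_integral_cmult[symmetric]) (auto simp: ennreal_mult pn0 qn0)
  also have "\<dots> \<le> (\<integral>\<^sup>+\<omega>. ennreal ((T \<omega> - N)\<^sup>2 * pn \<omega>) + ennreal ((T \<omega> + N)\<^sup>2 * qn \<omega>) + ennreal (N\<^sup>2 / 4 * (pn \<omega> + qn \<omega>)) \<partial>?P)"
    using two_point_pointwise[OF pn0 qn0]
    by (intro nn_integral_mono) (simp add: ennreal_leI pn0 qn0 flip: ennreal_plus)
  also have "\<dots> = ?X + ?Y + ennreal (N\<^sup>2 / 2)"
    unfolding X Y Z[symmetric] by (subst nn_integral_add, simp, simp, subst nn_integral_add) auto
  finally have *: "ennreal (N\<^sup>2) \<le> ?X + ?Y + ennreal (N\<^sup>2 / 2)" .
  show ?thesis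
  \<comment> \<open>Cancelling \<open>N^2 / 2\<close> is done in the reals; an infinite sum
    satisfies the bound trivially.\<close>
  proof (cases "?X + ?Y")
    case (real r)
    then have "ennreal (N\<^sup>2) \<le> ennreal (r + N\<^sup>2 / 2)" using * by (simp add: ennreal_plus)
    then have "N\<^sup>2 \<le> r + N\<^sup>2 / 2" using real(1) by (subst (asm) ennreal_le_iff) auto
    then have "N\<^sup>2 / 2 \<le> r" by simp
    then show ?thesis unfolding real(2) by (rule ennreal_leI)
  qed auto
qed

text \<open>Pairs every sign pattern having a minus at \<open>j\<close> with its flip at
  \<open>j\<close>.\<close>

lemma sum_Pow_split:
  fixes h :: "'j set \<Rightarrow> 'b::comm_monoid_add"
  assumes "finite J" "j \<in> J"
  shows "(\<Sum>S\<in>Pow J. h S) = (\<Sum>S\<in>Pow (J - {j}). h S + h (insert j S))"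
proof -
  have "Pow J = Pow (J - {j}) \<union> insert j ` Pow (J - {j})"
    using assms(2) Pow_insert[of j "J - {j}"] by (simp add: insert_absorb)
  moreover have "Pow (J - {j}) \<inter> insert j ` Pow (J - {j}) = {}" by auto
  moreover have "inj_on (insert j) (Pow (J - {j}))" by (auto simp: inj_on_def)
  ultimately show ?thesis
    using assms(1) by (simp add: sum.union_disjoint sum.reindex sum.distrib)
qed

text \<open>The worst pattern is at least as bad as the average one, and in the average each index
  can be treated by its own pairs.\<close>

lemma assouad_sum:
  fixes F :: "'j \<Rightarrow> 'j set \<Rightarrow> ennreal"
  assumes fin: "finite J" and c: "0 \<le> c"
    and pair: "\<And>j S. j \<in> J \<Longrightarrow> S \<subseteq> J - {j} \<Longrightarrow> ennreal c \<le> F j S + F j (insert j S)"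
    and Z: "\<And>S. S \<subseteq> J \<Longrightarrow> (\<Sum>j\<in>J. F j S) \<le> Z"
  shows "ennreal (real (card J) * c / 2) \<le> Z"
proof (cases "J = {}")
  case False
  \<comment> \<open>Each index has \<open>2 ^ K\<close> pairs of patterns differing only there,
    against \<open>2 ^ Suc K\<close> patterns in all; this ratio is the factor 1/2 of the
    conclusion.\<close>
  define K where "K = card J - 1"
  have K: "card J = Suc K" using False fin by (simp add: K_def card_gt_0_iff)
  have "ennreal (real (card J) * c * 2 ^ K) = (\<Sum>j\<in>J. \<Sum>S\<in>Pow (J - {j}). ennreal c)"
  proof -
    have "(\<Sum>j\<in>J. \<Sum>S\<in>Pow (J - {j}). ennreal c) = ennreal (\<Sum>j\<in>J. \<Sum>S\<in>Pow (J - {j}). c)"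
      using c by (simp add: sum_ennreal sum_nonneg del: sum_constant)
    also have "(\<Sum>j\<in>J. \<Sum>S\<in>Pow (J - {j}). c) = real (card J) * c * 2 ^ K"
      using fin by (simp add: K_def card_Pow)
    finally show ?thesis by simp
  qed
  also have "\<dots> \<le> (\<Sum>j\<in>J. \<Sum>S\<in>Pow (J - {j}). F j S + F j (insert j S))"
    using pair by (intro sum_mono) auto
  also have "\<dots> = (\<Sum>j\<in>J. \<Sum>S\<in>Pow J. F j S)"
    by (intro sum.cong refl sum_Pow_split[symmetric] fin)
  also have "\<dots> = (\<Sum>S\<in>Pow J. \<Sum>j\<in>J. F j S)" by (rule sum.swap)
  also have "\<dots> \<le> (\<Sum>S\<in>Pow J. Z)" using Z by (intro sum_mono) auto
  also have "\<dots> = ennreal (2 ^ Suc K) * Z"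
    using fin by (simp add: card_Pow K ennreal_of_nat_eq_real_of_nat)
  finally have *: "ennreal (real (card J) * c * 2 ^ K) \<le> ennreal (2 ^ Suc K) * Z" .
  show ?thesis
  proof (cases Z)
    case (real z)
    then have "ennreal (real (card J) * c * 2 ^ K) \<le> ennreal (2 ^ Suc K * z)" using * by (simp add: ennreal_mult)
    then have "real (card J) * c * 2 ^ K \<le> 2 ^ Suc K * z" using real(1) by (subst (asm) ennreal_le_iff) auto
    then have "real (card J) * c / 2 \<le> z" by simp
    then show ?thesis unfolding real(2) by (rule ennreal_leI)
  qed simp
qed simp

section \<open>Hellinger affinity of single observations\<close>

lemma sqrt_normal_density_mult:
  "sqrt (normal_density a 1 y * normal_density b 1 y) = exp (- (a - b)\<^sup>2 / 8) * normal_density ((a + b) / 2) 1 y"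
proof (rule real_sqrt_unique)
  \<comment> \<open>Completing the square: with \<open>m\<close> the midpoint,
    \<open>(y - a)^2 + (y - b)^2 = 2 (y - m)^2 + (a - b)^2 / 2\<close>.\<close>
  have e: "exp (- (y - a)\<^sup>2 / 2) * exp (- (y - b)\<^sup>2 / 2) =
      (exp (- (a - b)\<^sup>2 / 8))\<^sup>2 * (exp (- (y - (a + b) / 2)\<^sup>2 / 2))\<^sup>2"
    unfolding exp_double[symmetric] exp_add[symmetric]
    by (simp add: power2_eq_square field_simps)
  show "(exp (- (a - b)\<^sup>2 / 8) * normal_density ((a + b) / 2) 1 y)\<^sup>2 = normal_density a 1 y * normal_density b 1 y"
    using e by (simp add: normal_density_def power_mult_distrib power_divide power2_eq_square field_simps)
qed simp

definition obs_density :: "(real^'n \<Rightarrow> real) \<Rightarrow> (real^'n) \<times> real \<Rightarrow> real" where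
  "obs_density f = (\<lambda>(x, y). indicator Omega x * normal_density (f x) 1 y)"

lemma obs_density_measurable [measurable]:
  assumes [measurable]: "f \<in> borel_measurable borel"
  shows "obs_density f \<in> borel_measurable (lborel \<Otimes>\<^sub>M lborel)"
  unfolding obs_density_def normal_density_def by measurable

lemma obs_density_nonneg: "0 \<le> obs_density f z"
  by (auto simp: obs_density_def split: prod.split)

text \<open>Tonelli, integrating the noise first. It serves with \<open>h\<close> the indicator of
  \<open>Omega\<close> for normalisation and with \<open>h\<close> the Gaussian affinity at
  \<open>x\<close> for the Hellinger bound.\<close>

lemma nn_integral_Omega_normal:
  fixes h m :: "real^'n \<Rightarrow> real"
  assumes [measurable]: "h \<in> borel_measurable borel" "m \<in> borel_measurable borel" and h: "\<And>x. 0 \<le> h x"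
  shows "(\<integral>\<^sup>+z. ennreal (h (fst z) * normal_density (m (fst z)) 1 (snd z)) \<partial>(lborel \<Otimes>\<^sub>M lborel)) =
     (\<integral>\<^sup>+x. ennreal (h x) \<partial>lborel)"
proof -
  have "(\<integral>\<^sup>+y. ennreal (normal_density \<mu> 1 y) \<partial>lborel) = 1" for \<mu>
    by (simp add: nn_integral_eq_integral)
  then have "(\<integral>\<^sup>+y. ennreal (h x * normal_density (m x) 1 y) \<partial>lborel) = ennreal (h x)" for x
    using h by (simp add: ennreal_mult nn_integral_cmult)
  moreover have "(\<lambda>z. ennreal (h (fst z) * normal_density (m (fst z)) 1 (snd z))) \<in> borel_measurable (lborel \<Otimes>\<^sub>M lborel)"
    unfolding normal_density_def by measurable
  ultimately show ?thesis by (subst lborel.nn_integral_fst[symmetric]) auto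
qed

lemma nn_integral_obs_density:
  assumes "f \<in> borel_measurable borel"
  shows "(\<integral>\<^sup>+z. ennreal (obs_density f z) \<partial>(lborel \<Otimes>\<^sub>M lborel)) = 1"
proof -
  have "(\<integral>\<^sup>+x. ennreal (indicator Omega x) \<partial>(lborel :: (real^'n) measure)) = 1"
    using emeasure_Omega[where 'n='n] by (simp add: ennreal_indicator)
  then show ?thesis
    using nn_integral_Omega_normal[of "indicator Omega" f] assms
    by (simp add: obs_density_def case_prod_beta)
qed

text \<open>The affinity equals the integral over \<open>Omega\<close> of
  \<open>exp(-(f - g)^2 / 8)\<close>, which is at least \<open>1 - (f - g)^2 / 8\<close>; this
  deviates from 1 only on \<open>C\<close>, by at most \<open>D^2 / 8\<close>.\<close>

lemma obs_density_affinity: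
  fixes f g :: "real^'n \<Rightarrow> real"
  assumes [measurable]: "f \<in> borel_measurable borel" "g \<in> borel_measurable borel"
    and C: "C \<in> sets borel" "C \<subseteq> Omega"
    and fg: "AE x in lborel. x \<in> Omega \<longrightarrow> \<bar>f x - g x\<bar> \<le> D * indicator C x"
    and \<epsilon>: "D\<^sup>2 * measure lborel C \<le> 8 * \<epsilon>"
  shows "ennreal (1 - \<epsilon>) \<le> (\<integral>\<^sup>+z. ennreal (sqrt (obs_density f z * obs_density g z)) \<partial>(lborel \<Otimes>\<^sub>M lborel))"
proof -
  let ?h = "\<lambda>x. indicator Omega x * exp (- (f x - g x)\<^sup>2 / 8)"
  have finC: "emeasure lborel C < \<infinity>" "emeasure lborel (Omega :: (real^'n) set) < \<infinity>"
    using emeasure_mono[OF C(2), of lborel] emeasure_Omega[where 'n='n] by (auto simp: le_less_trans)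
  have I: "integrable lborel (\<lambda>x. indicator Omega x - D\<^sup>2 / 8 * indicator C x :: real)"
    using C finC by (intro Bochner_Integration.integrable_diff integrable_mult_right integrable_real_indicator) auto
  have "1 - \<epsilon> \<le> 1 - D\<^sup>2 / 8 * measure lborel C" using \<epsilon> by simp
  also have "\<dots> = (LINT x|lborel. indicator Omega x - D\<^sup>2 / 8 * indicator C x)"
    using C finC emeasure_Omega[where 'n='n]
    by (subst Bochner_Integration.integral_diff) (auto simp: measure_def intro!: integrable_real_indicator)
  finally have "ennreal (1 - \<epsilon>) \<le> ennreal (LINT x|lborel. indicator Omega x - D\<^sup>2 / 8 * indicator C x)"
    by (rule ennreal_leI)
  also have "\<dots> \<le> (\<integral>\<^sup>+x. ennreal (indicator Omega x - D\<^sup>2 / 8 * indicator C x) \<partial>lborel)"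
  proof -
    \<comment> \<open>The linear minorant may be negative on \<open>C\<close>;
      \<open>ennreal\<close> truncates it at 0, which can only enlarge the integral.\<close>
    let ?F = "\<lambda>x::real^'n. indicator Omega x - D\<^sup>2 / 8 * indicator C x :: real"
    have "ennreal (integral\<^sup>L lborel ?F) \<le> ennreal (LINT x|lborel. max 0 (?F x))"
      using I by (intro ennreal_leI integral_mono) auto
    also have "\<dots> = (\<integral>\<^sup>+x. ennreal (max 0 (?F x)) \<partial>lborel)"
      using I by (intro nn_integral_eq_integral[symmetric]) auto
    also have "\<dots> = (\<integral>\<^sup>+x. ennreal (?F x) \<partial>lborel)"
      by (intro nn_integral_cong) (auto simp: max_def ennreal_neg)
    finally show ?thesis .
  qed
  also have "\<dots> \<le> (\<integral>\<^sup>+x. ennreal (?h x) \<partial>lborel)"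
  proof (rule nn_integral_mono_AE)
    show "AE x in lborel. ennreal (indicator Omega x - D\<^sup>2 / 8 * indicator C x) \<le> ennreal (?h x)"
      using fg
    proof eventually_elim
      case (elim x)
      show ?case
      proof (cases "x \<in> Omega")
        case True
        then have "\<bar>f x - g x\<bar> \<le> D * indicator C x" using elim by simp
        then have "(f x - g x)\<^sup>2 \<le> D\<^sup>2 * indicator C x"
          using abs_le_square_iff[of "f x - g x" "D * indicator C x"]
          by (auto simp: power_mult_distrib indicator_def split: if_splits)
        moreover have "1 + (- (f x - g x)\<^sup>2 / 8) \<le> exp (- (f x - g x)\<^sup>2 / 8)" by (rule exp_ge_add_one_self)
        ultimately show ?thesis using True by (intro ennreal_leI) simp
      qed (use C(2) in \<open>auto simp: indicator_def\<close>)
    qed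
  qed
  also have "\<dots> = (\<integral>\<^sup>+z. ennreal (?h (fst z) * normal_density ((f (fst z) + g (fst z)) / 2) 1 (snd z)) \<partial>(lborel \<Otimes>\<^sub>M lborel))"
    by (rule nn_integral_Omega_normal[symmetric]) auto
  also have "\<dots> = (\<integral>\<^sup>+z. ennreal (sqrt (obs_density f z * obs_density g z)) \<partial>(lborel \<Otimes>\<^sub>M lborel))"
    by (intro nn_integral_cong) (auto simp: obs_density_def sqrt_normal_density_mult indicator_def)
  finally show ?thesis .
qed

subsection \<open>The perturbations\<close>

text \<open>Scale 4 confines the support to \<open>[1/4, 3/4]\<close> in each coordinate and keeps
  the value at the centre nonzero; any scale above 2 would do that.\<close>

definition bump :: "real^'n \<Rightarrow> real" where
  "bump = box_bump 0 1 4"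

text \<open>Blows the cell with index \<open>j\<close> up to the unit cube; scaling plus translation
  is the shape that \<open>dpart_affine\<close> and \<open>flat_alg_affine\<close> expect.\<close>

definition cell_map :: "nat \<Rightarrow> ('n \<Rightarrow> nat) \<Rightarrow> real^'n \<Rightarrow> real^'n" where
  "cell_map M j x = real M *\<^sub>R x + (\<chi> i. - real (j i))"

definition cell :: "nat \<Rightarrow> ('n \<Rightarrow> nat) \<Rightarrow> (real^'n) set" where
  "cell M j = {x. cell_map M j x \<in> box 0 1}"

definition grid :: "nat \<Rightarrow> ('n \<Rightarrow> nat) set" where
  "grid M = {j. \<forall>i. j i < M}"

text \<open>Sign patterns are encoded as the set \<open>S\<close> of cells with a plus sign, so that
  flipping a sign is \<open>insert\<close> and averaging runs over a power set.\<close>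

definition perturb :: "real \<Rightarrow> nat \<Rightarrow> ('n \<Rightarrow> nat) set \<Rightarrow> real^'n \<Rightarrow> real" where
  "perturb A M S x = (\<Sum>j\<in>grid M. (if j \<in> S then A else - A) * bump (cell_map M j x))"

lemma flat_alg_affine:
  fixes c :: "real^'n"
  shows "f \<in> flat_alg \<Longrightarrow> (\<lambda>x. f (m *\<^sub>R x + c)) \<in> flat_alg"
proof (induction rule: flat_alg.induct)
  case (flat p m' i c')
  have "(\<lambda>x. flat_exp p ((m' * m) * x $ i + (m' * c $ i + c'))) \<in> flat_alg" by (rule flat_alg.flat)
  then show ?case by (simp add: algebra_simps)
qed (auto intro: flat_alg.intros)

lemma bump_flat_alg: "bump \<in> flat_alg"
  by (simp add: bump_def box_bump_flat_alg)

lemma bump_smooth: "smooth bump"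
  by (rule flat_alg_smooth[OF bump_flat_alg])

lemma bump_support: "closure {x. bump x \<noteq> 0} \<subseteq> box 0 1"
  unfolding bump_def by (rule box_bump_support) simp

lemma bump_test_fun: "test_fun bump"
  by (rule test_funI[OF bump_smooth bump_support])

lemma bump_center: "bump (\<chi> i. 1 / 2) \<noteq> 0"
  by (auto simp: bump_def box_bump_def flat_exp_1_nonzero_iff)

lemma dpart_bump_off: "y \<notin> box 0 1 \<Longrightarrow> dpart l bump y = 0"
  by (rule test_fun_dpart_0[OF bump_test_fun])

text \<open>Only finitely many lists have length at most \<open>k\<close>, so the individual bounds
  can be summed; the extra 1 makes the constant positive.\<close>

lemma bump_dpart_bounded:
  obtains C where "0 < C" "\<And>l x. length l \<le> k \<Longrightarrow> \<bar>dpart l (bump :: real^'n \<Rightarrow> real) x\<bar> \<le> C"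
proof -
  let ?L = "{l :: 'n list. set l \<subseteq> UNIV \<and> length l \<le> k}"
  have fin: "finite ?L" by (rule finite_lists_length_le) simp
  have "\<exists>C. \<forall>x. \<bar>dpart l (bump :: real^'n \<Rightarrow> real) x\<bar> \<le> C" for l
  proof -
    have "continuous_on UNIV (dpart l (bump :: real^'n \<Rightarrow> real))"
      by (intro smooth_continuous smooth_dpart bump_smooth)
    moreover have "dpart l (bump :: real^'n \<Rightarrow> real) x = 0" if "x \<notin> cbox 0 1" for x
      using that box_subset_cbox dpart_bump_off by blast
    ultimately show ?thesis
      using bounded_compact_support[of "dpart l bump" "cbox 0 1"] compact_cbox by metis
  qed
  then obtain B where B: "\<And>l x. \<bar>dpart l (bump :: real^'n \<Rightarrow> real) x\<bar> \<le> B l" by metis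
  define C where "C = 1 + (\<Sum>l\<in>?L. B l)"
  have B0: "0 \<le> B l" for l using B[of l undefined] by linarith
  have "\<bar>dpart l (bump :: real^'n \<Rightarrow> real) x\<bar> \<le> C" if "length l \<le> k" for l x
    using B[of l x] member_le_sum[of l ?L B] that fin B0 by (simp add: C_def)
  moreover have "0 < C" using B0 by (simp add: C_def add_pos_nonneg sum_nonneg)
  ultimately show thesis using that by blast
qed

text \<open>Along each line in direction \<open>i\<close> the function is constant, and far out it
  is 0. This keeps the iterated pure derivatives of the bump from vanishing identically.\<close>

lemma partial_zero_imp_zero:
  assumes f: "smooth f" and K: "bounded {x. f x \<noteq> 0}" and 0: "\<And>x. partial i f x = 0"
  shows "f x = 0"
proof -
  obtain r where r: "\<And>x. f x \<noteq> 0 \<Longrightarrow> norm x \<le> r" using K by (auto simp: bounded_iff)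
  \<comment> \<open>Moving this far along the axis leaves the ball of radius \<open>r\<close>
    whatever the direction of \<open>x\<close>.\<close>
  define t where "t = r + norm x + 1"
  have "((\<lambda>t. f (x + t *\<^sub>R axis i 1)) has_real_derivative 0) (at t)" for t
    using smooth_has_partial[OF f, of x i t] 0 by simp
  then have "f (x + 0 *\<^sub>R axis i 1) = f (x + t *\<^sub>R axis i 1)"
    using DERIV_isconst_all[of "\<lambda>t. f (x + t *\<^sub>R axis i 1)"] by blast
  moreover have "norm (x + t *\<^sub>R axis i 1) \<ge> \<bar>t\<bar> - norm x"
    using norm_triangle_ineq4[of "x + t *\<^sub>R axis i 1" x] by (simp add: norm_axis_1)
  then have "f (x + t *\<^sub>R axis i 1) = 0"
    using r[of "x + t *\<^sub>R axis i 1"] unfolding t_def by fastforce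
  ultimately show ?thesis by simp
qed

lemma dpart_bump_nonzero: "\<exists>x. dpart (replicate k i) bump x \<noteq> 0"
proof (induction k)
  case 0
  then show ?case using bump_center by auto
next
  case (Suc k)
  have "bounded {x. dpart (replicate k i) bump x \<noteq> 0}"
    using dpart_bump_off bounded_box[of 0 1] by (metis (mono_tags, lifting) bounded_subset mem_Collect_eq subsetI)
  then show ?case
    using Suc partial_zero_imp_zero[OF smooth_dpart[OF bump_smooth], of "replicate k i" i] by auto
qed

text \<open>The derivative is continuous and not identically 0, and a nonempty open set is not null.
  This makes the constant of the lower bound positive.\<close>

lemma dpart_bump_integral_pos: "0 < (LINT x|lborel. (dpart (replicate k i) (bump :: real^'n \<Rightarrow> real) x)\<^sup>2)"
proof -
  let ?G = "dpart (replicate k i) (bump :: real^'n \<Rightarrow> real)"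
  have c: "continuous_on UNIV ?G" by (intro smooth_continuous smooth_dpart bump_smooth)
  have c2: "continuous_on UNIV (\<lambda>x. (?G x)\<^sup>2)" by (intro continuous_intros c)
  have off: "(?G x)\<^sup>2 = 0" if "x \<notin> cbox 0 1" for x
    using that box_subset_cbox[of 0 1] dpart_bump_off[of x] by auto
  have int: "integrable lborel (\<lambda>x. (?G x)\<^sup>2)"
    by (rule integrable_compact_support[OF c2 compact_cbox[of 0 1] off])
  have "(LINT x|lborel. (?G x)\<^sup>2) \<noteq> 0"
  proof
    assume "(LINT x|lborel. (?G x)\<^sup>2) = 0"
    then have "AE x in lborel. (?G x)\<^sup>2 = 0"
      using integral_nonneg_eq_0_iff_AE[OF int] by simp
    moreover have op: "open {x. ?G x \<noteq> 0}"
      using c by (intro open_Collect_neq continuous_on_const)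
    ultimately have "{x. ?G x \<noteq> 0} \<in> null_sets lborel"
      by (subst AE_iff_null_sets) auto
    then have "negligible {x. ?G x \<noteq> 0}"
      by (simp add: negligible_iff_null_sets null_sets_completionI)
    then have "{x. ?G x \<noteq> 0} = {}" using op open_not_negligible by blast
    then show False using dpart_bump_nonzero[of k i] by blast
  qed
  moreover have "0 \<le> (LINT x|lborel. (?G x)\<^sup>2)" by simp
  ultimately show ?thesis by linarith
qed

section \<open>Geometry of the grid and size of the perturbations\<close>

lemma cell_map_in_box_iff:
  "cell_map M j x \<in> box 0 1 \<longleftrightarrow> (\<forall>i. real (j i) < real M * x $ i \<and> real M * x $ i < real (j i) + 1)"
  by (simp add: cell_map_def mem_box_cart algebra_simps)

lemma cell_disjoint:
  assumes "x \<in> cell M j" "x \<in> cell M j'"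
  shows "j = j'"
proof
  fix i
  have "real (j i) < real M * x $ i" "real M * x $ i < real (j i) + 1"
    "real (j' i) < real M * x $ i" "real M * x $ i < real (j' i) + 1"
    using assms by (auto simp: cell_def cell_map_in_box_iff)
  then show "j i = j' i" by linarith
qed

lemma cell_eq_box:
  assumes "0 < M"
  shows "cell M j = box (\<chi> i. real (j i) / real M) (\<chi> i. (real (j i) + 1) / real M)"
proof (rule set_eqI)
  fix x
  show "x \<in> cell M j \<longleftrightarrow> x \<in> box (\<chi> i. real (j i) / real M) (\<chi> i. (real (j i) + 1) / real M)"
    unfolding cell_def mem_Collect_eq cell_map_in_box_iff using assms
    by (simp add: mem_box_cart divide_less_eq less_divide_eq mult.commute)
qed

lemma measure_cell:
  assumes "0 < M"
  shows "measure lborel (cell M j :: (real^'n) set) = (1 / real M) ^ CARD('n)"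
proof -
  let ?a = "\<chi> i. real (j i) / real M" and ?b = "\<chi> i. (real (j i) + 1) / real M"
  have "?a \<bullet> b \<le> ?b \<bullet> b \<and> (?b - ?a) \<bullet> b = 1 / real M" if "b \<in> (Basis :: (real^'n) set)" for b
    using that assms by (auto simp: Basis_vec_def inner_axis divide_right_mono diff_divide_distrib[symmetric])
  then have "measure lborel (cell M j) = (\<Prod>b\<in>(Basis :: (real^'n) set). 1 / real M)"
    unfolding cell_eq_box[OF assms] by (subst measure_lborel_box) (auto intro!: prod.cong)
  then show ?thesis by simp
qed

lemma cell_subset:
  assumes "0 < M" "j \<in> grid M"
  shows "cell M j \<subseteq> box 0 1"
proof
  fix x assume x: "x \<in> cell M j"
  show "x \<in> box 0 1"
    unfolding mem_box_cart
  proof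
    fix i
    have *: "real (j i) < real M * x $ i" "real M * x $ i < real (j i) + 1"
      using x by (auto simp: cell_def cell_map_in_box_iff)
    have "real (j i) + 1 \<le> real M" using assms(2) by (simp add: grid_def flip: nat_less_real_le)
    then have "0 < real M * x $ i" "real M * x $ i < real M * 1" using * by linarith+
    then show "0 $ i < x $ i \<and> x $ i < 1 $ i"
      using assms(1) by (simp add: zero_less_mult_iff)
  qed
qed

lemma finite_grid: "finite (grid M :: ('n::finite \<Rightarrow> nat) set)"
  and card_grid: "card (grid M :: ('n::finite \<Rightarrow> nat) set) = M ^ CARD('n)"
proof -
  have "grid M = PiE (UNIV :: 'n set) (\<lambda>_. {..<M})" by (auto simp: grid_def PiE_UNIV_domain)
  then show "finite (grid M :: ('n \<Rightarrow> nat) set)" "card (grid M :: ('n \<Rightarrow> nat) set) = M ^ CARD('n)"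
    by (auto simp: card_PiE intro: finite_PiE)
qed

lemma bump_cell_flat_alg: "(\<lambda>x. bump (cell_map M j x)) \<in> flat_alg"
  unfolding cell_map_def by (rule flat_alg_affine[OF bump_flat_alg])

lemma dpart_bump_cell: "dpart l (\<lambda>x. bump (cell_map M j x)) = (\<lambda>x. real M ^ length l * dpart l bump (cell_map M j x))"
  unfolding cell_map_def by (rule dpart_affine[OF bump_smooth])

lemma dpart_perturb:
  "dpart l (perturb A M S) = (\<lambda>x. \<Sum>j\<in>grid M. (if j \<in> S then A else - A) * (real M ^ length l * dpart l bump (cell_map M j x)))"
  unfolding perturb_def
  by (subst dpart_linear_sum) (auto intro: flat_alg_smooth bump_cell_flat_alg simp: dpart_bump_cell)

lemma perturb_test_fun:
  assumes "0 < M"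
  shows "test_fun (perturb A M S)"
proof (rule test_funI)
  show "smooth (perturb A M S)"
    unfolding perturb_def
    by (intro flat_alg_smooth flat_alg_sum flat_alg.mult flat_alg.const bump_cell_flat_alg)
  \<comment> \<open>Preimages of the closed bump support, unlike the open cells, form a closed
    finite union that still lies inside the open cube.\<close>
  let ?U = "\<Union>j\<in>grid M. cell_map M j -` closure {x. bump x \<noteq> 0}"
  have "closed ?U"
    unfolding cell_map_def by (intro closed_UN finite_grid closed_vimage) (auto intro!: continuous_intros)
  moreover have "{x. perturb A M S x \<noteq> 0} \<subseteq> ?U"
  proof
    fix x assume "x \<in> {x. perturb A M S x \<noteq> 0}"
    then obtain j where "j \<in> grid M" "bump (cell_map M j x) \<noteq> 0"
      unfolding perturb_def by (force dest: sum.not_neutral_contains_not_neutral)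
    then show "x \<in> ?U" using closure_subset[of "{x. bump x \<noteq> 0}"] by auto
  qed
  ultimately have "closure {x. perturb A M S x \<noteq> 0} \<subseteq> ?U" by (rule closure_minimal[rotated])
  also have "\<dots> \<subseteq> box 0 1"
    using bump_support cell_subset[OF assms] unfolding cell_def by blast
  finally show "closure {x. perturb A M S x \<noteq> 0} \<subseteq> box 0 1" .
qed

text \<open>At most one summand is nonzero at any point, so the bound does not grow with the number
  of cells.\<close>

lemma dpart_perturb_bound:
  assumes C: "\<And>x. \<bar>dpart l bump x\<bar> \<le> C" and A: "0 \<le> A"
  shows "\<bar>dpart l (perturb A M S) x\<bar> \<le> A * real M ^ length l * C"
proof -
  let ?h = "\<lambda>j. (if j \<in> S then A else - A) * (real M ^ length l * dpart l bump (cell_map M j x))"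
  have C0: "0 \<le> C" using C[of undefined] by linarith
  have h0: "?h j = 0" if "x \<notin> cell M j" for j using that dpart_bump_off[of "cell_map M j x" l] by (simp add: cell_def)
  have hb: "\<bar>?h j\<bar> \<le> A * real M ^ length l * C" for j
    using C[of "cell_map M j x"] A by (auto simp: abs_mult mult.assoc intro!: mult_left_mono)
  show ?thesis
  proof (cases "\<exists>j0\<in>grid M. x \<in> cell M j0")
    case True
    then obtain j0 where j0: "j0 \<in> grid M" "x \<in> cell M j0" by blast
    have "(\<Sum>j\<in>grid M. ?h j) = (\<Sum>j\<in>{j0}. ?h j)"
      using j0 h0 cell_disjoint[OF j0(2)] by (intro sum.mono_neutral_right finite_grid) blast+
    then show ?thesis using hb[of j0] unfolding dpart_perturb by simp
  next
    case False
    then have "(\<Sum>j\<in>grid M. ?h j) = 0" using h0 by (intro sum.neutral) blast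
    then show ?thesis unfolding dpart_perturb using A C0 by simp
  qed
qed

lemma ip_self_le:
  assumes f: "L2 f" and b: "\<And>x. \<bar>f x\<bar> \<le> B"
  shows "ip f f \<le> B\<^sup>2"
proof -
  have fin: "emeasure lborel (Omega :: (real^'a) set) < \<infinity>" by (simp add: emeasure_Omega)
  have "ip f f \<le> (LINT x|lborel. B\<^sup>2 * indicator (Omega :: (real^'a) set) x)"
    unfolding ip_def
  proof (rule integral_mono)
    show "integrable lborel (\<lambda>x. indicator Omega x * (f x * f x))" by (rule L2_integrable[OF f f])
    show "integrable lborel (\<lambda>x. B\<^sup>2 * indicator (Omega :: (real^'a) set) x :: real)"
      using fin by (intro integrable_mult_right integrable_real_indicator) auto
    show "indicator Omega x * (f x * f x) \<le> B\<^sup>2 * indicator Omega x" for x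
      using abs_le_square_iff[of "f x" B] b[of x] by (auto simp: indicator_def power2_eq_square)
  qed
  also have "\<dots> = B\<^sup>2" using emeasure_Omega[where 'n='a] by (simp add: measure_def)
  finally show ?thesis .
qed

lemma ip_wderiv_test_fun:
  assumes "test_fun u" "L2 g"
  shows "ip (wderiv \<alpha> u) g = ip (dpart (rev (lst \<alpha>)) u) g"
proof (rule ip_cong_AE[OF _ _ assms(2,2) wderiv_test_fun[OF assms(1)]])
  show "L2 (wderiv \<alpha> u)" by (rule L2_wderiv[OF test_fun_Hk[OF assms(1)] order.refl])
  show "L2 (dpart (rev (lst \<alpha>)) u)"
    by (intro L2_continuous smooth_continuous smooth_dpart test_fun_smooth assms(1))
qed simp

lemma sob_norm_test_fun_le:
  fixes u :: "real^'n \<Rightarrow> real"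
  assumes u: "test_fun u" and B: "\<And>l x. length l \<le> k \<Longrightarrow> \<bar>dpart l u x\<bar> \<le> B"
  shows "(sob_norm k u)\<^sup>2 \<le> real (card {\<alpha> :: 'n \<Rightarrow> nat. sum \<alpha> UNIV \<le> k}) * B\<^sup>2"
proof -
  have "ip (wderiv \<alpha> u) (wderiv \<alpha> u) \<le> B\<^sup>2" if "sum \<alpha> UNIV \<le> k" for \<alpha>
  proof -
    have L: "L2 (dpart (rev (lst \<alpha>)) u)"
      by (intro L2_continuous smooth_continuous smooth_dpart test_fun_smooth u)
    have "ip (wderiv \<alpha> u) (wderiv \<alpha> u) = ip (dpart (rev (lst \<alpha>)) u) (dpart (rev (lst \<alpha>)) u)"
      by (metis L L2_wderiv[OF test_fun_Hk[OF u] order.refl] ip_commute ip_wderiv_test_fun[OF u])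
    also have "\<dots> \<le> B\<^sup>2" using B that by (intro ip_self_le L) (simp add: length_lst)
    finally show ?thesis .
  qed
  then have "sob_ip k u u \<le> (\<Sum>\<alpha> :: 'n \<Rightarrow> nat | sum \<alpha> UNIV \<le> k. B\<^sup>2)"
    unfolding sob_ip_def by (intro sum_mono) auto
  then show ?thesis by (simp add: sob_norm_sq)
qed

lemma test_fun_H10:
  fixes u :: "real^'n \<Rightarrow> real"
  assumes "test_fun u"
  shows "u \<in> H10"
proof -
  have "(sob_norm 1 (\<lambda>x::real^'n. 0))\<^sup>2 \<le> real (card {\<alpha> :: 'n \<Rightarrow> nat. sum \<alpha> UNIV \<le> 1}) * 0\<^sup>2"
  proof (rule sob_norm_test_fun_le[OF test_fun_zero])
    show "\<bar>dpart l (\<lambda>x::real^'n. 0) x\<bar> \<le> 0" for l and x :: "real^'n"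
      using dpart_eq_0_off_support[of x "\<lambda>x. 0" l] by simp
  qed
  then have "sob_norm 1 (\<lambda>x::real^'n. u x - u x) = 0" by simp
  then show ?thesis using assms test_fun_Hk[OF assms] unfolding H10_def by force
qed

text \<open>Differentiating \<open>s\<close> times costs \<open>M^s\<close>, exactly offset by the
  amplitude; lower orders cost less because \<open>M\<close> is at least 1.\<close>

lemma perturb_Ucls:
  fixes S :: "('n::finite \<Rightarrow> nat) set"
  assumes M: "0 < M" and C: "\<And>l x. length l \<le> s \<Longrightarrow> \<bar>dpart l (bump :: real^'n \<Rightarrow> real) x\<bar> \<le> C"
    and \<rho>: "0 \<le> \<rho>" and R: "real (card {\<alpha> :: 'n \<Rightarrow> nat. sum \<alpha> UNIV \<le> s}) * (\<rho> * C)\<^sup>2 \<le> R\<^sup>2" "0 \<le> R"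
  shows "perturb (\<rho> / real M ^ s) M S \<in> Ucls s R"
proof -
  let ?u = "perturb (\<rho> / real M ^ s) M S"
  have u: "test_fun ?u" by (rule perturb_test_fun[OF M])
  have C0: "0 \<le> C" using C[of "[]" undefined] by simp
  have "\<bar>dpart l ?u x\<bar> \<le> \<rho> * C" if "length l \<le> s" for l x
  proof -
    have "\<bar>dpart l ?u x\<bar> \<le> \<rho> / real M ^ s * real M ^ length l * C"
      by (rule dpart_perturb_bound) (use C[OF that] \<rho> in auto)
    also have "\<dots> \<le> \<rho> / real M ^ s * real M ^ s * C"
      using M that \<rho> C0 by (intro mult_right_mono mult_left_mono power_increasing) auto
    finally show ?thesis using M by simp
  qed
  then have "(sob_norm s ?u)\<^sup>2 \<le> R\<^sup>2"
    by (rule order_trans[OF sob_norm_test_fun_le[OF u] R(1)])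
  then have "sob_norm s ?u \<le> R" using R(2) by (rule power2_le_imp_le)
  then show ?thesis using u by (simp add: Ucls_def test_fun_Hk test_fun_H10)
qed

lemma source_measurable:
  assumes V: "V \<in> borel_measurable borel" and u: "u \<in> Hk s" "2 \<le> s"
  shows "source V u \<in> borel_measurable borel"
proof -
  have "wderiv (\<lambda>j. if j = i then 2 else 0) u \<in> borel_measurable borel" for i
    using L2_wderiv[OF u(1), of "\<lambda>j. if j = i then 2 else 0"] u(2) by (simp add: L2_def)
  moreover have "u \<in> borel_measurable borel" using u by (simp add: Hk_def L2_def)
  ultimately show ?thesis using V unfolding source_def[abs_def] wlap_def by measurable
qed

lemma source_test_fun:
  assumes "test_fun u"
  shows "AE x in lborel. x \<in> Omega \<longrightarrow> source V u x = - (\<Sum>i\<in>UNIV. dpart [i, i] u x) + V x * u x"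
proof -
  have "AE x in lborel. x \<in> Omega \<longrightarrow> wderiv (\<lambda>j. if j = i then 2 else 0) u x = dpart [i, i] u x" for i
    using wderiv_test_fun[OF assms, of "\<lambda>j. if j = i then 2 else 0"]
    by (simp add: lst_single numeral_2_eq_2)
  then have "AE x in lborel. \<forall>i. x \<in> Omega \<longrightarrow> wderiv (\<lambda>j. if j = i then 2 else 0) u x = dpart [i, i] u x"
    by (intro AE_all_countable[THEN iffD2] allI) auto
  then show ?thesis by eventually_elim (simp add: source_def wlap_def)
qed

lemma perturb_insert_diff:
  assumes "j \<in> grid M" "j \<notin> S"
  shows "dpart l (perturb A M (insert j S)) x - dpart l (perturb A M S) x =
    2 * A * real M ^ length l * dpart l bump (cell_map M j x)"
proof -
  have "dpart l (perturb A M (insert j S)) x - dpart l (perturb A M S) x =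
    (\<Sum>j'\<in>grid M. if j' = j then 2 * A * real M ^ length l * dpart l bump (cell_map M j x) else 0)"
    unfolding dpart_perturb sum_subtractf[symmetric] using assms(2) by (intro sum.cong) auto
  then show ?thesis using assms(1) by (simp add: finite_grid)
qed

lemma source_perturb_diff:
  fixes V :: "real^'n \<Rightarrow> real"
  assumes M: "0 < M" and j: "j \<in> grid M" "j \<notin> S" and A: "0 \<le> A"
    and C: "\<And>l x. length l \<le> 2 \<Longrightarrow> \<bar>dpart l (bump :: real^'n \<Rightarrow> real) x\<bar> \<le> C"
    and V: "AE x in lborel. x \<in> Omega \<longrightarrow> \<bar>V x\<bar> \<le> B" and B: "0 \<le> B"
  shows "AE x in lborel. x \<in> Omega \<longrightarrow>
    \<bar>source V (perturb A M (insert j S)) x - source V (perturb A M S) x\<bar>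
      \<le> 2 * A * real M ^ 2 * C * (real CARD('n) + B) * indicator (cell M j) x"
  using source_test_fun[OF perturb_test_fun[OF M], of V A "insert j S"]
    source_test_fun[OF perturb_test_fun[OF M], of V A S] V
proof eventually_elim
  case (elim x)
  show ?case
  proof
    assume x: "x \<in> Omega"
    have C0: "0 \<le> C" using C[of "[]" undefined] by simp
    let ?y = "cell_map M j x"
    have eq: "source V (perturb A M (insert j S)) x - source V (perturb A M S) x =
      2 * A * (- (\<Sum>i\<in>UNIV. real M ^ 2 * dpart [i, i] bump ?y) + V x * bump ?y)"
    proof -
      \<comment> \<open>Writing the function itself as \<open>dpart []\<close> lets
        \<open>perturb_insert_diff\<close> treat the Laplacian and the potential term alike.\<close>
      have "source V (perturb A M (insert j S)) x - source V (perturb A M S) x =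
        - (\<Sum>i\<in>UNIV. dpart [i, i] (perturb A M (insert j S)) x - dpart [i, i] (perturb A M S) x)
        + V x * (dpart [] (perturb A M (insert j S)) x - dpart [] (perturb A M S) x)"
        using elim x by (simp add: sum_subtractf algebra_simps)
      also have "\<dots> = - (\<Sum>i\<in>UNIV. 2 * A * real M ^ 2 * dpart [i, i] bump ?y) + V x * (2 * A * bump ?y)"
        unfolding perturb_insert_diff[OF j] by (simp add: numeral_2_eq_2)
      finally show ?thesis by (simp add: sum_distrib_left algebra_simps)
    qed
    show "\<bar>source V (perturb A M (insert j S)) x - source V (perturb A M S) x\<bar>
      \<le> 2 * A * real M ^ 2 * C * (real CARD('n) + B) * indicator (cell M j) x"
    proof (cases "x \<in> cell M j")
      case False
      then have "dpart l bump ?y = 0" for l using dpart_bump_off[of ?y l] by (simp add: cell_def)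
      from this[of "[]"] this[of "[i, i]" for i] show ?thesis using False unfolding eq by simp
    next
      case True
      have "\<bar>\<Sum>i\<in>UNIV. real M ^ 2 * dpart [i, i] bump ?y\<bar> \<le> (\<Sum>i\<in>(UNIV :: 'n set). real M ^ 2 * C)"
      proof (intro order_trans[OF sum_abs] sum_mono)
        show "\<bar>real M ^ 2 * dpart [i, i] bump ?y\<bar> \<le> real M ^ 2 * C" for i
          using C[of "[i, i]" ?y] by (simp add: abs_mult mult_left_mono)
      qed
      then have 1: "\<bar>\<Sum>i\<in>UNIV. real M ^ 2 * dpart [i, i] bump ?y\<bar> \<le> real M ^ 2 * C * real CARD('n)"
        by (simp add: mult_ac)
      have "\<bar>V x * bump ?y\<bar> \<le> B * C"
        using elim x C[of "[]" ?y] B by (auto simp: abs_mult intro!: mult_mono)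
      \<comment> \<open>The potential term carries no factor \<open>M\<close>; it is absorbed into
        the second-order scale since \<open>M\<close> is at least 1.\<close>
      also have "\<dots> \<le> real M ^ 2 * C * B"
        using mult_right_mono[of 1 "real M ^ 2" "C * B"] M B C0 by (simp add: mult_ac)
      finally have 2: "\<bar>- (\<Sum>i\<in>UNIV. real M ^ 2 * dpart [i, i] bump ?y) + V x * bump ?y\<bar> \<le>
          real M ^ 2 * C * (real CARD('n) + B)"
        using 1 by (simp add: distrib_left)
      have "\<bar>source V (perturb A M (insert j S)) x - source V (perturb A M S) x\<bar> \<le>
          2 * A * (real M ^ 2 * C * (real CARD('n) + B))"
        unfolding eq abs_mult[of "2 * A"] using A 2 by (simp add: mult_left_mono)
      then show ?thesis using True by (simp add: mult_ac)
    qed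
  qed
qed

subsection \<open>Bessel's inequality\<close>

lemma ip_sum_left:
  assumes "\<And>j. j \<in> J \<Longrightarrow> L2 (f j)" "L2 h"
  shows "ip (\<lambda>x. \<Sum>j\<in>J. c j * f j x) h = (\<Sum>j\<in>J. c j * ip (f j) h)"
proof -
  have "ip (\<lambda>x. \<Sum>j\<in>J. c j * f j x) h = (LINT x|lborel. (\<Sum>j\<in>J. c j * (indicator Omega x * (f j x * h x))))"
    by (simp add: ip_def sum_distrib_left sum_distrib_right mult_ac)
  also have "\<dots> = (\<Sum>j\<in>J. (LINT x|lborel. c j * (indicator Omega x * (f j x * h x))))"
    using assms by (intro Bochner_Integration.integral_sum integrable_mult_right L2_integrable)
  finally show ?thesis by (simp add: ip_def)
qed

lemma L2_sum:
  assumes "\<And>j. j \<in> J \<Longrightarrow> L2 (f j)"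
  shows "L2 (\<lambda>x. \<Sum>j\<in>J. c j * f j x)"
  using assms
proof (induction J rule: infinite_finite_induct)
  case (insert j J)
  have "L2 (\<lambda>x. (\<Sum>j\<in>J. c j * f j x) + c j * f j x)"
    using insert by (intro L2_add_scaled) auto
  then show ?case using insert.hyps by (simp add: add.commute)
qed (auto simp: L2_const)

text \<open>The squared norm of \<open>h\<close> minus its projection onto the span of the
  \<open>g j\<close> is nonnegative; the family is orthogonal with common squared norm
  \<open>N\<close> instead of 1.\<close>

lemma bessel:
  assumes J: "finite J" and g: "\<And>j. j \<in> J \<Longrightarrow> L2 (g j)" and h: "L2 h" and N: "0 < N"
    and orth: "\<And>i j. i \<in> J \<Longrightarrow> j \<in> J \<Longrightarrow> ip (g i) (g j) = (if i = j then N else 0)"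
  shows "(\<Sum>j\<in>J. (ip h (g j))\<^sup>2 / N) \<le> ip h h"
proof -
  define c where "c j = ip h (g j) / N" for j
  let ?F = "\<lambda>x. \<Sum>j\<in>J. c j * g j x"
  have F: "L2 ?F" by (rule L2_sum[OF g])
  have 1: "ip h ?F = (\<Sum>j\<in>J. c j * ip h (g j))"
    using ip_sum_left[of J g h c] g h ip_commute[of h] by (metis (no_types, lifting) sum.cong)
  have "ip (g i) ?F = c i * N" if "i \<in> J" for i
  proof -
    have "ip (g i) ?F = ip ?F (g i)" by (rule ip_commute)
    also have "ip ?F (g i) = (\<Sum>j\<in>J. c j * ip (g j) (g i))"
      using g that by (intro ip_sum_left) auto
    also have "\<dots> = (\<Sum>j\<in>J. if j = i then c i * N else 0)"
      using orth that by (intro sum.cong) auto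
    finally show ?thesis using J that by simp
  qed
  then have "(\<Sum>j\<in>J. c j * ip (g j) ?F) = (\<Sum>j\<in>J. c j * (c j * N))" by simp
  then have 2: "ip ?F ?F = (\<Sum>j\<in>J. c j * (c j * N))"
    using ip_sum_left[of J g ?F c, OF g F] by (rule trans[rotated])
  have "0 \<le> ip h h - 2 * ip h ?F + ip ?F ?F"
    using ip_add_scaled_self[OF h F, of "-1"] ip_nonneg[of "\<lambda>x. h x + (-1) * ?F x"] by simp
  also have "\<dots> = ip h h - (\<Sum>j\<in>J. (ip h (g j))\<^sup>2 / N)"
  proof -
    have "c j * (c j * N) = (ip h (g j))\<^sup>2 / N" "c j * ip h (g j) = (ip h (g j))\<^sup>2 / N" for j
      using N by (simp_all add: c_def power2_eq_square)
    then show ?thesis unfolding 1 2 by simp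
  qed
  finally show ?thesis by simp
qed

lemma integral_cell_map:
  fixes F :: "real^'n \<Rightarrow> real"
  assumes M: "0 < M" and F [measurable]: "F \<in> borel_measurable borel"
  shows "(LINT x|lborel. F (cell_map M j x)) = (LINT x|lborel. F x) / real M ^ CARD('n)"
proof -
  define t :: "real^'n" where "t = (\<chi> i. - real (j i))"
  have "(LINT x|lborel. F x) = integral\<^sup>L (density (distr lborel borel (\<lambda>x. t + real M *\<^sub>R x)) (\<lambda>_. \<bar>real M\<bar> ^ DIM(real^'n))) F"
    using M by (subst lborel_affine[of "real M" t]) auto
  also have "\<dots> = real M ^ CARD('n) * integral\<^sup>L (distr lborel borel (\<lambda>x. t + real M *\<^sub>R x)) F"
    by (subst integral_density) auto
  also have "\<dots> = real M ^ CARD('n) * (LINT x|lborel. F (cell_map M j x))"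
    by (subst integral_distr) (auto simp: cell_map_def t_def add.commute)
  finally show ?thesis using M by simp
qed

text \<open>Off the diagonal the supports are disjoint; on it, rescaling one cell to the unit cube
  produces the factor \<open>1 / M^d\<close>.\<close>

lemma perturbation_derivs_orthogonal:
  fixes l :: "'n::finite list"
  assumes M: "0 < M" and j: "i \<in> grid M" "j \<in> grid M"
  shows "ip (\<lambda>x. A * (real M ^ length l * dpart l bump (cell_map M i x)))
            (\<lambda>x. A * (real M ^ length l * dpart l bump (cell_map M j x))) =
    (if i = j then A\<^sup>2 * real M ^ (2 * length l) / real M ^ CARD('n) * (LINT x|lborel. (dpart l bump x)\<^sup>2) else 0)"
proof (cases "i = j")
  case True
  let ?G = "dpart l (bump :: real^'n \<Rightarrow> real)"
  have G: "?G (cell_map M j x) = 0" if "x \<notin> Omega" for x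
  proof -
    have "x \<notin> cell M j" using cell_subset[OF M j(2)] that box_subset_cbox[of 0 1] by (auto simp: Omega_eq_cbox)
    then show ?thesis by (simp add: cell_def dpart_bump_off)
  qed
  have [measurable]: "?G \<in> borel_measurable borel" by (intro smooth_measurable smooth_dpart bump_smooth)
  have "ip (\<lambda>x. A * (real M ^ length l * ?G (cell_map M i x))) (\<lambda>x. A * (real M ^ length l * ?G (cell_map M j x)))
     = (LINT x|lborel. A\<^sup>2 * real M ^ (2 * length l) * (?G (cell_map M j x))\<^sup>2)"
    unfolding ip_def True using G
    by (intro Bochner_Integration.integral_cong)
       (auto simp: indicator_def power2_eq_square mult_2 power_add)
  also have "\<dots> = A\<^sup>2 * real M ^ (2 * length l) * (LINT x|lborel. (?G (cell_map M j x))\<^sup>2)" by simp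
  also have "(LINT x|lborel. (?G (cell_map M j x))\<^sup>2) = (LINT x|lborel. (?G x)\<^sup>2) / real M ^ CARD('n)"
    by (rule integral_cell_map[OF M]) measurable
  finally show ?thesis using True by simp
next
  case False
  have "dpart l bump (cell_map M i x) = 0 \<or> dpart l bump (cell_map M j x) = 0" for x :: "real^'n"
    using False cell_disjoint[of x M i j] dpart_bump_off[of "cell_map M i x" l] dpart_bump_off[of "cell_map M j x" l]
    by (auto simp: cell_def)
  then have "indicator Omega x * (A * (real M ^ length l * dpart l bump (cell_map M i x)) *
     (A * (real M ^ length l * dpart l bump (cell_map M j x)))) = 0" for x :: "real^'n"
    by auto
  then show ?thesis using False unfolding ip_def by (simp only:) simp
qed

section \<open>The lower bound for a given grid\<close>

lemma sample_law_eq: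
  "sample_law n V u = PiM {..<n} (\<lambda>_. density (lborel \<Otimes>\<^sub>M lborel) (\<lambda>z. ennreal (obs_density (source V u) z)))"
  unfolding sample_law_def obs_law_def obs_density_def
  by (intro arg_cong2[where f = PiM] refl ext arg_cong2[where f = density]) auto

text \<open>Bridges the product \<open>borel\<close> space on which estimators are measurable and
  the product \<open>lborel\<close> space on which the sample law has a density.\<close>

lemma sets_PiM_lborel:
  "sets (PiM I (\<lambda>_. lborel \<Otimes>\<^sub>M lborel)) = sets (PiM I (\<lambda>_. borel :: ((real^'n) \<times> real) measure))"
proof (rule sets_PiM_cong)
  show "sets (lborel \<Otimes>\<^sub>M lborel) = sets (borel :: ((real^'n) \<times> real) measure)"
    unfolding borel_prod[symmetric] by (intro sets_pair_measure_cong) auto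
qed simp

text \<open>The two conditions on \<open>\<rho>\<close> have different purposes: \<open>R\<close>
  keeps every sign pattern in the class, while \<open>small\<close> together with \<open>nM\<close>
  keeps the affinity loss per observation at most \<open>1 / (2 n)\<close>. The grid size is
  optimised only afterwards.\<close>

lemma minimax_risk_lower_bound:
  fixes V :: "real^'n \<Rightarrow> real" and i0 :: 'n
  assumes s: "2 \<le> s" and k: "k \<le> 2" and n: "1 \<le> n" and M: "0 < M"
    and C: "\<And>l x. length l \<le> s \<Longrightarrow> \<bar>dpart l (bump :: real^'n \<Rightarrow> real) x\<bar> \<le> C"
    and \<rho>: "0 < \<rho>"
    and R: "real (card {\<alpha> :: 'n \<Rightarrow> nat. sum \<alpha> UNIV \<le> s}) * (\<rho> * C)\<^sup>2 \<le> R\<^sup>2" "0 \<le> R"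
    and V: "V \<in> borel_measurable borel" "AE x in lborel. x \<in> Omega \<longrightarrow> \<bar>V x\<bar> \<le> B" and B: "0 \<le> B"
    and small: "\<rho> * C * (real CARD('n) + B) \<le> 1"
    and nM: "n \<le> M ^ (CARD('n) + 2 * s - 4)"
  shows "ennreal (\<rho>\<^sup>2 * (LINT x|lborel. (dpart (replicate k i0) bump x)\<^sup>2) / 4 / real M ^ (2 * s - 2 * k))
    \<le> minimax_risk V s R n k"
  unfolding minimax_risk_def
proof (rule INF_greatest)
  fix \<psi> :: "(nat \<Rightarrow> (real^'n) \<times> real) \<Rightarrow> real^'n \<Rightarrow> real"
  assume "\<psi> \<in> {\<psi>. estimator s n \<psi>}"
  then have est: "estimator s n \<psi>" by simp
  define A where "A = \<rho> / real M ^ s"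
  define l where "l = replicate k i0"
  define a where "a = (\<lambda>j. if j = i0 then k else 0)"
  define g where "g j x = A * (real M ^ k * dpart l bump (cell_map M j x))" for j and x :: "real^'n"
  define I where "I = (LINT x|lborel. (dpart l (bump :: real^'n \<Rightarrow> real) x)\<^sup>2)"
  \<comment> \<open>The common squared norm of the \<open>g j\<close>, and hence, up to sign, the
    true value that \<open>T j\<close> should estimate.\<close>
  define N where "N = A\<^sup>2 * real M ^ (2 * k) / real M ^ CARD('n) * I"
  define u where "u S = perturb A M S" for S :: "('n \<Rightarrow> nat) set"
  define T where "T j \<omega> = ip (wderiv a (\<psi> \<omega>)) (g j)" for j \<omega>
  define Z where "Z = (SUP u\<in>Ucls s R. \<integral>\<^sup>+ \<omega>. ennreal ((sob_norm k (\<lambda>x. \<psi> \<omega> x - u x))\<^sup>2) \<partial>sample_law n V u)"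
  let ?J = "grid M :: ('n \<Rightarrow> nat) set"
  let ?P = "PiM {..<n} (\<lambda>_. lborel \<Otimes>\<^sub>M lborel) :: (nat \<Rightarrow> (real^'n) \<times> real) measure"
  have len: "length l = k" by (simp add: l_def)
  have a: "sum a UNIV = k" "lst a = l" by (simp_all add: a_def l_def lst_single)
  have A0: "0 < A" using \<rho> M by (simp add: A_def)
  have I0: "0 < I" unfolding I_def l_def by (rule dpart_bump_integral_pos)
  have N0: "0 < N" using A0 I0 M by (simp add: N_def)
  have C0: "0 \<le> C" using C[of "[]" undefined] by simp
  have ks: "k \<le> s" using k s by simp
  have uU: "u S \<in> Ucls s R" for S unfolding u_def A_def by (rule perturb_Ucls[OF M C]) (use \<rho> R in auto)
  have ut: "test_fun (u S)" for S unfolding u_def by (rule perturb_test_fun[OF M])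
  have uH: "u S \<in> Hk m" for S m by (rule test_fun_Hk[OF ut])
  have gL: "L2 (g j)" for j
  proof -
    have "g j = (\<lambda>x. A * dpart l (\<lambda>x. bump (cell_map M j x)) x)"
      by (simp add: g_def[abs_def] dpart_bump_cell len)
    moreover have "continuous_on UNIV (\<lambda>x. A * dpart l (\<lambda>x. bump (cell_map M j x)) x)"
      by (intro continuous_on_mult continuous_on_const smooth_continuous smooth_dpart flat_alg_smooth bump_cell_flat_alg)
    ultimately show ?thesis by (simp add: L2_continuous)
  qed
  have orth: "ip (g i) (g j) = (if i = j then N else 0)" if "i \<in> ?J" "j \<in> ?J" for i j
    using perturbation_derivs_orthogonal[OF M that, of A l] by (simp add: g_def[abs_def] N_def I_def len)
  have ipu: "ip (wderiv a (u S)) (g j) = (if j \<in> S then N else - N)" if j: "j \<in> ?J" for S j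
  proof -
    have "ip (wderiv a (u S)) (g j) = ip (dpart l (u S)) (g j)"
      using ip_wderiv_test_fun[OF ut gL, of a] by (simp add: a(2) l_def)
    also have "dpart l (u S) = (\<lambda>x. \<Sum>i\<in>?J. (if i \<in> S then 1 else - 1) * g i x)"
      unfolding u_def dpart_perturb g_def len by (intro ext sum.cong) auto
    also have "ip \<dots> (g j) = (\<Sum>i\<in>?J. (if i \<in> S then 1 else - 1) * ip (g i) (g j))"
      by (intro ip_sum_left gL)
    also have "\<dots> = (\<Sum>i\<in>?J. if i = j then (if j \<in> S then N else - N) else 0)"
      using orth j by (intro sum.cong) auto
    finally show ?thesis using j by (simp add: finite_grid)
  qed
  have sp: "space ?P = space (PiM {..<n} (\<lambda>_. borel :: ((real^'n) \<times> real) measure))"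
    by (rule sets_eq_imp_space_eq[OF sets_PiM_lborel])
  have \<psi>H: "\<psi> \<omega> \<in> Hk s" if "\<omega> \<in> space ?P" for \<omega>
    using est that unfolding sp estimator_def by blast
  have T: "T j \<in> borel_measurable ?P" for j
    using estimator_functional_measurable[OF est gL, of a j] a(1) ks
    by (simp add: T_def[abs_def] measurable_cong_sets[OF sets_PiM_lborel refl])
  \<comment> \<open>Dividing by \<open>N\<close> is the Bessel normalisation that lets the
    coordinate errors sum to at most the loss.\<close>
  define F where "F j S = (\<integral>\<^sup>+\<omega>. ennreal ((T j \<omega> - (if j \<in> S then N else - N))\<^sup>2 / N) \<partial>sample_law n V (u S))" for j S
  have setsS: "sets (sample_law n V (u S)) = sets ?P" for S
    unfolding sample_law_eq by (rule sets_PiM_cong) auto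
  have spS: "space (sample_law n V (u S)) = space ?P" for S
    by (rule sets_eq_imp_space_eq[OF setsS])
  have TS: "T j \<in> borel_measurable (sample_law n V (u S))" for j S
    using T by (simp add: measurable_cong_sets[OF setsS refl])
  have meas: "(\<lambda>\<omega>. ennreal ((T j \<omega> - c)\<^sup>2 / b)) \<in> borel_measurable (sample_law n V (u S))" for j S c b
    by (rule measurable_compose[OF TS, of "\<lambda>t. ennreal ((t - c)\<^sup>2 / b)"]) measurable
  have loss: "(\<Sum>j\<in>?J. (T j \<omega> - (if j \<in> S then N else - N))\<^sup>2 / N) \<le> (sob_norm k (\<lambda>x. \<psi> \<omega> x - u S x))\<^sup>2"
    if \<omega>: "\<omega> \<in> space ?P" for S \<omega>
  proof -
    define e where "e = (\<lambda>x. \<psi> \<omega> x + (-1) * u S x)"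
    have eH: "e \<in> Hk s" unfolding e_def by (rule Hk_add_scaled[OF \<psi>H[OF \<omega>] uH])
    have as: "sum a UNIV \<le> s" using a ks by simp
    have "ip (wderiv a e) (g j) = T j \<omega> - (if j \<in> S then N else - N)" if "j \<in> ?J" for j
      unfolding e_def ip_wderiv_add_scaled[OF \<psi>H[OF \<omega>] uH as gL] ipu[OF that] T_def by simp
    then have "(\<Sum>j\<in>?J. (T j \<omega> - (if j \<in> S then N else - N))\<^sup>2 / N) = (\<Sum>j\<in>?J. (ip (wderiv a e) (g j))\<^sup>2 / N)"
      by (intro sum.cong) auto
    also have "\<dots> \<le> ip (wderiv a e) (wderiv a e)"
      by (rule bessel[OF finite_grid gL L2_wderiv[OF eH as] N0 orth])
    also have "\<dots> \<le> (sob_norm k e)\<^sup>2" by (rule ip_wderiv_le_sob_norm) (simp add: a)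
    finally show ?thesis by (simp add: e_def)
  qed
  have upper: "(\<Sum>j\<in>?J. F j S) \<le> Z" for S
  proof -
    have "(\<Sum>j\<in>?J. F j S) = (\<integral>\<^sup>+\<omega>. (\<Sum>j\<in>?J. ennreal ((T j \<omega> - (if j \<in> S then N else - N))\<^sup>2 / N)) \<partial>sample_law n V (u S))"
      unfolding F_def by (intro nn_integral_sum[symmetric] meas)
    also have "\<dots> = (\<integral>\<^sup>+\<omega>. ennreal (\<Sum>j\<in>?J. (T j \<omega> - (if j \<in> S then N else - N))\<^sup>2 / N) \<partial>sample_law n V (u S))"
      using N0 by (intro nn_integral_cong sum_ennreal) auto
    \<comment> \<open>Only monotonicity of the integral touches the loss, whose measurability is not
      known; sum and integral were exchanged on the measurable side.\<close>
    also have "\<dots> \<le> (\<integral>\<^sup>+\<omega>. ennreal ((sob_norm k (\<lambda>x. \<psi> \<omega> x - u S x))\<^sup>2) \<partial>sample_law n V (u S))"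
      by (intro nn_integral_mono ennreal_leI loss) (simp add: spS)
    also have "\<dots> \<le> Z" unfolding Z_def by (rule SUP_upper[OF uU])
    finally show ?thesis .
  qed
  have pair: "ennreal (N / 2) \<le> F j S + F j (insert j S)" if j: "j \<in> ?J" and S: "S \<subseteq> ?J - {j}" for j S
  proof -
    have jS: "j \<notin> S" using S by blast
    define p where "p S = obs_density (source V (u S))" for S
    have src: "source V (u S) \<in> borel_measurable borel" for S by (rule source_measurable[OF V(1) uH s])
    have [measurable]: "p S \<in> borel_measurable (lborel \<Otimes>\<^sub>M lborel)" for S
      unfolding p_def by (rule obs_density_measurable[OF src])
    define D where "D = 2 * A * real M ^ 2 * C * (real CARD('n) + B)"
    have aff: "ennreal (1 - 1 / (2 * real n)) \<le> (\<integral>\<^sup>+z. ennreal (sqrt (p (insert j S) z * p S z)) \<partial>(lborel \<Otimes>\<^sub>M lborel))"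
      unfolding p_def
    proof (rule obs_density_affinity[OF src src, where C = "cell M j" and D = D])
      show "cell M j \<in> sets borel" by (simp add: cell_eq_box[OF M])
      show "cell M j \<subseteq> Omega" using cell_subset[OF M j] box_subset_cbox[of 0 1] by (auto simp: Omega_eq_cbox)
      show "AE x in lborel. x \<in> Omega \<longrightarrow> \<bar>source V (u (insert j S)) x - source V (u S) x\<bar> \<le> D * indicator (cell M j) x"
        unfolding u_def D_def
        by (rule source_perturb_diff[OF M j jS less_imp_le[OF A0] _ V(2) B]) (use C s in auto)
      \<comment> \<open>The powers of \<open>M\<close> collect to \<open>M^(4 - 2s - d)\<close>,
        which \<open>nM\<close> bounds by \<open>1 / n\<close>.\<close>
      have "D\<^sup>2 * measure lborel (cell M j) =
          4 * (\<rho> * C * (real CARD('n) + B))\<^sup>2 * (real M ^ 4 / (real M ^ (2 * s) * real M ^ CARD('n)))"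
        unfolding D_def A_def measure_cell[OF M]
        by (simp add: power_mult_distrib power_divide power_mult[symmetric] mult_ac)
      also have "\<dots> \<le> 4 * 1 * (1 / real n)"
      proof (intro mult_mono)
        show "(\<rho> * C * (real CARD('n) + B))\<^sup>2 \<le> 1"
          using small \<rho> C0 B by (simp add: power_le_one)
        have "real n * real M ^ 4 \<le> real M ^ (CARD('n) + 2 * s - 4) * real M ^ 4"
          using nM by (intro mult_right_mono) (auto simp flip: of_nat_power)
        also have "\<dots> = real M ^ (2 * s) * real M ^ CARD('n)"
          using s by (simp add: power_add[symmetric] add.commute)
        finally show "real M ^ 4 / (real M ^ (2 * s) * real M ^ CARD('n)) \<le> 1 / real n"
          using M n by (simp add: divide_le_eq le_divide_eq mult.commute)
      qed auto
      finally show "D\<^sup>2 * measure lborel (cell M j) \<le> 8 * (1 / (2 * real n))" by simp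
    qed
    \<comment> \<open>Under \<open>insert j S\<close> the functional \<open>T j\<close> aims at
      \<open>N\<close>, under \<open>S\<close> at \<open>-N\<close>.\<close>
    have "ennreal (N\<^sup>2 / 2) \<le> (\<integral>\<^sup>+\<omega>. (T j \<omega> - N)\<^sup>2 \<partial>sample_law n V (u (insert j S))) +
      (\<integral>\<^sup>+\<omega>. (T j \<omega> + N)\<^sup>2 \<partial>sample_law n V (u S))"
      unfolding sample_law_eq
    proof (rule two_point_product[OF _ _ _ _ _ _ _ _ n T])
      show "sigma_finite_measure (lborel \<Otimes>\<^sub>M lborel :: ((real^'n) \<times> real) measure)"
        by (rule lborel_pair.sigma_finite_measure_axioms)
      show "(\<integral>\<^sup>+z. ennreal (obs_density (source V (u (insert j S))) z) \<partial>(lborel \<Otimes>\<^sub>M lborel)) = 1"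
        "(\<integral>\<^sup>+z. ennreal (obs_density (source V (u S)) z) \<partial>(lborel \<Otimes>\<^sub>M lborel)) = 1"
        by (rule nn_integral_obs_density[OF src])+
      show "ennreal (1 - 1 / (2 * real n)) \<le> (\<integral>\<^sup>+z. ennreal (sqrt (obs_density (source V (u (insert j S))) z *
          obs_density (source V (u S)) z)) \<partial>(lborel \<Otimes>\<^sub>M lborel))"
        using aff by (simp add: p_def)
    qed (auto intro: obs_density_measurable[OF src] obs_density_nonneg)
    then have "ennreal (1 / N) * ennreal (N\<^sup>2 / 2) \<le> ennreal (1 / N) * ((\<integral>\<^sup>+\<omega>. (T j \<omega> - N)\<^sup>2 \<partial>sample_law n V (u (insert j S))) +
      (\<integral>\<^sup>+\<omega>. (T j \<omega> + N)\<^sup>2 \<partial>sample_law n V (u S)))"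
      by (rule mult_left_mono) simp
    also have "\<dots> = F j (insert j S) + F j S"
    proof -
      have "ennreal (1 / N) * (\<integral>\<^sup>+\<omega>. (T j \<omega> - c)\<^sup>2 \<partial>sample_law n V (u S)) =
          (\<integral>\<^sup>+\<omega>. ennreal ((T j \<omega> - c)\<^sup>2 / N) \<partial>sample_law n V (u S))" for c S
        using N0 meas[of j c 1 S] by (subst nn_integral_cmult[symmetric]) (auto simp: ennreal_mult[symmetric])
      from this[of "insert j S" N] this[of S "- N"] show ?thesis
        unfolding F_def distrib_left using jS by simp
    qed
    also have "ennreal (1 / N) * ennreal (N\<^sup>2 / 2) = ennreal (N / 2)"
      using N0 by (subst ennreal_mult[symmetric]) (auto simp: power2_eq_square)
    finally show ?thesis by (simp add: add.commute)
  qed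
  have "ennreal (real (card ?J) * (N / 2) / 2) \<le> Z"
    by (rule assouad_sum[OF finite_grid _ pair upper]) (use N0 in auto)
  \<comment> \<open>The number \<open>M^d\<close> of cells cancels the factor \<open>1 / M^d\<close>
    in \<open>N\<close>.\<close>
  also have "real (card ?J) * (N / 2) / 2 = \<rho>\<^sup>2 * I / 4 / real M ^ (2 * s - 2 * k)"
  proof -
    have "real M ^ (2 * s) = real M ^ (2 * s - 2 * k) * real M ^ (2 * k)"
      using ks by (simp flip: power_add)
    then show ?thesis using M
      by (simp add: N_def A_def card_grid power_divide power_mult[symmetric] mult.commute[of s])
  qed
  finally show "ennreal (\<rho>\<^sup>2 * (LINT x|lborel. (dpart (replicate k i0) bump x)\<^sup>2) / 4 / real M ^ (2 * s - 2 * k)) \<le> Z"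
    by (simp add: I_def l_def)
qed

text \<open>Rounding the \<open>e\<close>-th root of \<open>n\<close> up at most doubles it, because
  that root is at least 1.\<close>

lemma grid_size:
  fixes n e :: nat
  assumes n: "1 \<le> n" and e: "1 \<le> e"
  obtains M where "0 < M" "n \<le> M ^ e" "real M \<le> 2 * real n powr (1 / real e)"
proof -
  define y where "y = real n powr (1 / real e)"
  have y1: "1 \<le> y" using n by (simp add: y_def ge_one_powr_ge_zero)
  define M where "M = nat \<lceil>y\<rceil>"
  have yM: "y \<le> real M" unfolding M_def by (rule real_nat_ceiling_ge)
  have "real M \<le> y + 1" unfolding M_def using y1 by linarith
  then have "real M \<le> 2 * y" using y1 by simp
  moreover have "real n = y ^ e"
    using n e y1 by (simp add: y_def powr_realpow[symmetric] powr_powr)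
  then have "real n \<le> real M ^ e" using yM y1 by (simp add: power_mono)
  then have "n \<le> M ^ e" by (simp flip: of_nat_power)
  moreover have "0 < M" using yM y1 by (cases M) auto
  ultimately show thesis using that unfolding y_def by blast
qed

theorem theorem3p1:
  fixes V :: "real^'n \<Rightarrow> real" and s :: nat and R :: real
  assumes "s \<ge> 2" and "R > 0"
    and "V \<in> borel_measurable borel"
    and "\<exists>B. AE x in lborel. x \<in> Omega \<longrightarrow> \<bar>V x\<bar> \<le> B"
  shows "\<exists>c>0. \<forall>n\<ge>1.
     minimax_risk V s R n 1 \<ge>
       ennreal (c * real n powr (- (2 * real s - 2) / (real CARD('n) + 2 * real s - 4)))
   \<and> minimax_risk V s R n 2 \<ge>
       ennreal (c * real n powr (- (2 * real s - 4) / (real CARD('n) + 2 * real s - 4)))"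
proof -
  obtain B0 where "AE x in lborel. x \<in> Omega \<longrightarrow> \<bar>V x\<bar> \<le> B0" using assms(4) by blast
  \<comment> \<open>The given essential bound is not known to be nonnegative.\<close>
  define B where "B = max 0 B0"
  have V: "AE x in lborel. x \<in> Omega \<longrightarrow> \<bar>V x\<bar> \<le> B"
    using \<open>AE x in lborel. x \<in> Omega \<longrightarrow> \<bar>V x\<bar> \<le> B0\<close> by eventually_elim (auto simp: B_def)
  have B: "0 \<le> B" by (simp add: B_def)
  obtain C where C: "0 < C" "\<And>l x. length l \<le> s \<Longrightarrow> \<bar>dpart l (bump :: real^'n \<Rightarrow> real) x\<bar> \<le> C"
    using bump_dpart_bounded[of s] by blast
  define K where "K = real (card {\<alpha> :: 'n \<Rightarrow> nat. sum \<alpha> UNIV \<le> s})"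
  have "{\<alpha> :: 'n \<Rightarrow> nat. sum \<alpha> UNIV \<le> s} \<noteq> {}" by (auto intro!: exI[of _ "\<lambda>_. 0"])
  then have K: "1 \<le> K" using finite_multi_indices[of s] by (simp add: K_def card_gt_0_iff Suc_le_eq)
  define d where "d = real CARD('n)"
  have d: "1 \<le> d" by (simp add: d_def Suc_le_eq)
  \<comment> \<open>The first term places the perturbations in the Sobolev ball, where
    \<open>K >= 1\<close> lets \<open>K (R / K)^2\<close> stay below \<open>R^2\<close>; the second
    bounds the change of the source.\<close>
  define \<rho> where "\<rho> = min (R / (C * K)) (1 / (C * (d + B)))"
  have \<rho>0: "0 < \<rho>" using assms(2) C(1) K d B by (simp add: \<rho>_def)
  have "\<rho> * C \<le> R / (C * K) * C" using C(1) by (intro mult_right_mono) (auto simp: \<rho>_def)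
  then have "\<rho> * C \<le> R / K" using C(1) by simp
  then have "K * (\<rho> * C)\<^sup>2 \<le> K * (R / K)\<^sup>2" using \<rho>0 C(1) K by (intro mult_left_mono power_mono) auto
  also have "\<dots> = R\<^sup>2 / K" using K by (simp add: power2_eq_square)
  also have "\<dots> \<le> R\<^sup>2" using K by (simp add: divide_le_eq mult_le_cancel_left1)
  finally have \<rho>R: "K * (\<rho> * C)\<^sup>2 \<le> R\<^sup>2" .
  have "\<rho> * (C * (d + B)) \<le> 1 / (C * (d + B)) * (C * (d + B))"
    using C(1) d B by (intro mult_right_mono) (auto simp: \<rho>_def)
  then have small: "\<rho> * C * (d + B) \<le> 1" using C(1) d B by (simp add: mult.assoc)
  \<comment> \<open>Any coordinate direction serves: one pure derivative already carries the
    rate.\<close>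
  define i0 :: 'n where "i0 = undefined"
  define I where "I k = (LINT x|lborel. (dpart (replicate k i0) (bump :: real^'n \<Rightarrow> real) x)\<^sup>2)" for k
  have I: "0 < I k" for k unfolding I_def by (rule dpart_bump_integral_pos)
  \<comment> \<open>The power of 2 pays for the factor 2 lost in \<open>grid_size\<close>.\<close>
  define b where "b k = \<rho>\<^sup>2 * I k / 4 / 2 ^ (2 * s - 2 * k)" for k
  have b: "0 < b k" for k using \<rho>0 I by (simp add: b_def)
  define e where "e = CARD('n) + 2 * s - 4"
  have "0 < CARD('n)" by simp
  then have e: "1 \<le> e" "real e = real CARD('n) + 2 * real s - 4"
    using assms(1) unfolding e_def by linarith+
  define c where "c = min (b 1) (b 2)"
  have main: "ennreal (c * real n powr (- (2 * real s - 2 * real k) / (real CARD('n) + 2 * real s - 4))) \<le> minimax_risk V s R n k"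
    if n: "1 \<le> n" and k: "k = 1 \<or> k = 2" for n k
  proof -
    obtain M where M: "0 < M" "n \<le> M ^ e" "real M \<le> 2 * real n powr (1 / real e)"
      using grid_size[OF n e(1)] by blast
    have k2: "k \<le> 2" "k \<le> s" using k assms(1) by auto
    have low: "ennreal (\<rho>\<^sup>2 * I k / 4 / real M ^ (2 * s - 2 * k)) \<le> minimax_risk V s R n k"
      unfolding I_def
      by (rule minimax_risk_lower_bound[OF assms(1) k2(1) n M(1) C(2) \<rho>0 _ _ assms(3) V B])
         (use \<rho>R small M(2) assms(2) in \<open>auto simp: K_def d_def e_def\<close>)
    have "real M ^ (2 * s - 2 * k) \<le> (2 * real n powr (1 / real e)) ^ (2 * s - 2 * k)"
      using M(3) by (intro power_mono) auto
    also have "\<dots> = 2 ^ (2 * s - 2 * k) * real n powr ((2 * real s - 2 * real k) / real e)"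
    proof -
      have "(real n powr (1 / real e)) ^ (2 * s - 2 * k) = real n powr ((2 * real s - 2 * real k) / real e)"
        using n k2 by (simp add: powr_realpow[symmetric] powr_powr of_nat_diff)
      then show ?thesis by (simp add: power_mult_distrib)
    qed
    finally have Mle: "real M ^ (2 * s - 2 * k) \<le> 2 ^ (2 * s - 2 * k) * real n powr ((2 * real s - 2 * real k) / real e)" .
    have "c * real n powr (- (2 * real s - 2 * real k) / real e) \<le> b k * real n powr (- (2 * real s - 2 * real k) / real e)"
      using k by (intro mult_right_mono) (auto simp: c_def)
    also have "\<dots> = \<rho>\<^sup>2 * I k / 4 / (2 ^ (2 * s - 2 * k) * real n powr ((2 * real s - 2 * real k) / real e))"
      by (simp add: b_def powr_minus_divide minus_divide_left[symmetric] del: minus_diff_eq minus_divide_left)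
    also have "\<dots> \<le> \<rho>\<^sup>2 * I k / 4 / real M ^ (2 * s - 2 * k)"
      using Mle M(1) I[of k] n by (intro divide_left_mono mult_pos_pos) (auto simp: less_imp_le)
    finally show ?thesis using low e(2) by (metis ennreal_leI order_trans)
  qed
  show ?thesis
  proof (intro exI[of _ c] conjI allI impI)
    show "0 < c" using b by (simp add: c_def)
    fix n :: nat assume "1 \<le> n"
    from main[OF this, of 1] main[OF this, of 2]
    show "ennreal (c * real n powr (- (2 * real s - 2) / (real CARD('n) + 2 * real s - 4))) \<le> minimax_risk V s R n 1"
      "ennreal (c * real n powr (- (2 * real s - 4) / (real CARD('n) + 2 * real s - 4))) \<le> minimax_risk V s R n 2"
      by simp_all
  qed
qed

end
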